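(* Let $f$ be a given function and let $\Phi_{\rm ad}$ be its admissible space of maps (defined in the context). Let $\Phi_{\rm as,ad}$ be the asymptotically admissible subspace, consisting of those $\phi\in\Phi_{\rm ad}$ for which the admissibility conditions hold with some $d>0$, some weight $\omega$ and some constants $\alpha_1,\alpha_2,\beta_1,\beta_2,\gamma>0$ satisfying in addition $d\gamma=\pi/2$. Then for every $\phi_{\rm as}\in\Phi_{\rm as,ad}$, with associated $d,\omega,\alpha_1,\alpha_2,\beta_1,\beta_2,\gamma$, the following two bounds hold. (a) There is a constant $C_{d,\omega}$, depending on $d$ and $\omega$ (and not on $n$), such that for every positive integer $n$, with $N=2n+1$ and mesh size $$h=\frac{\log(\pi^2 n/\beta_2)}{\gamma n}>0,$$ one has $$\mathscr{E}^{\rm T}_{N,h}(H^\infty(\mathscr{D}_d,\omega))\le C_{d,\omega}\exp\left(-\frac{\pi^2N}{2\log\left(\pi^2N/(2\beta_2)\right)}\right).$$ (b) For this same $\phi_{\rm as}$ there is a constant $C_{d,\omega}$, depending on $d$ and $\omega$ (and not on $n$), such that for every positive integer $n$, with $N=2n+1$ and mesh size $$h=\frac{\log\left(\pi^2 n/(2\beta_2)\right)}{\gamma n}>0,$$ one has $$\mathscr{E}^{\rm Sinc}_{N,h}(H^\infty(\mathscr{D}_d,\omega))\le C_{d,\omega}\exp\left(-\frac{\pi^2N}{4\log\left(\pi^2N/(4\beta_2)\right)}\right).$$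
   Context: For $d>0$ let $\mathscr{D}_d=\{z\in\mathbb{C}:|\operatorname{Im} z|<d\}$. For a non-vanishing function $\omega$ on $\mathscr{D}_d$, let $H^\infty(\mathscr{D}_d,\omega)$ be the space of all functions $g:\mathscr{D}_d\to\mathbb{C}$ that are analytic in $\mathscr{D}_d$ and satisfy $\|g\|:=\sup_{z\in\mathscr{D}_d}|g(z)/\omega(z)|<+\infty$. $B(\mathscr{D}_d)$ denotes the family of all functions $g$ analytic in $\mathscr{D}_d$ such that $\mathcal{N}_1(g,\mathscr{D}_d)=\int_{\partial\mathscr{D}_d}|g(z)|\,|dz|<+\infty$. For a positive integer $n$, $N=2n+1$ and mesh size $h>0$, the error norm of the $N$-point trapezoidal rule is $$\mathscr{E}^{\rm T}_{N,h}(H^\infty(\mathscr{D}_d,\omega))=\sup_{\|g\|\le1}\left|\int_{-\infty}^{+\infty}g(x)\,dx-h\sum_{k=-n}^{n}g(kh)\right|,$$ and the error norm of the $N$-point Sinc approximation is $$\mathscr{E}^{\rm Sinc}_{N,h}(H^\infty(\mathscr{D}_d,\omega))=\sup_{\|g\|\le1}\left\{\sup_{x\in\mathbb{R}}\left|g(x)-\sum_{j=-n}^{n}g(jh)\,S(j,h)(x)\right|\right\},$$ where both suprema are over $g\in H^\infty(\mathscr{D}_d,\omega)$ with $\|g\|\le 1$, and $$S(j,h)(x)=\frac{\sin[\pi(x/h-j)]}{\pi(x/h-j)}$$ is the Sinc function (with value $1$ at $x=jh$). Given $f$, the admissible space $\Phi_{\rm ad}$ is the set of all functions $\phi$ such that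 $f(\phi(\cdot))\phi'(\cdot)\in H^\infty(\mathscr{D}_d,\omega)$ for some $d>0$ and some $\omega$ satisfying: 1. $\omega\in B(\mathscr{D}_d)$; 2. $\omega$ does not vanish at any point in $\mathscr{D}_d$ and takes real values on the real axis; 3. $\alpha_1\exp(-\beta_1e^{\gamma|x|})\le|\omega(x)|\le\alpha_2\exp(-\beta_2e^{\gamma|x|})$ for all $x\in\mathbb{R}$, where $\alpha_1,\alpha_2,\beta_1,\beta_2,\gamma>0$. *)

theory Defs
  imports "HOL-Complex_Analysis.Complex_Analysis" "HOL-Probability.Sinc_Integral"
begin

definition strip :: "real \<Rightarrow> complex set" where
  "strip d = {z. \<bar>Im z\<bar> < d}"

(* Functions on the strip are total functions on the complex plane; everything below
   depends only on their values in the open strip. *)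

definition H_norm :: "real \<Rightarrow> (complex \<Rightarrow> complex) \<Rightarrow> (complex \<Rightarrow> complex) \<Rightarrow> real" where
  "H_norm d \<omega> g = (SUP z\<in>strip d. norm (g z / \<omega> z))"

definition H_infty :: "real \<Rightarrow> (complex \<Rightarrow> complex) \<Rightarrow> (complex \<Rightarrow> complex) set" where
  "H_infty d \<omega> =
     {g. g analytic_on strip d \<and> bdd_above ((\<lambda>z. norm (g z / \<omega> z)) ` strip d)}"

definition H_unit_ball :: "real \<Rightarrow> (complex \<Rightarrow> complex) \<Rightarrow> (complex \<Rightarrow> complex) set" where
  "H_unit_ball d \<omega> = {g \<in> H_infty d \<omega>. H_norm d \<omega> g \<le> 1}"

(* The integral of |g(z)| |dz| over the boundary of the rectangle
   |Re z| < 1/\<epsilon>, |Im z| < d (1 - \<epsilon>), for 0 < \<epsilon> < 1. *)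
definition box_boundary_integral :: "(complex \<Rightarrow> complex) \<Rightarrow> real \<Rightarrow> real \<Rightarrow> real" where
  "box_boundary_integral g d \<epsilon> =
     (let a = 1 / \<epsilon>; c = d * (1 - \<epsilon>) in
        integral {-a..a} (\<lambda>x. norm (g (Complex x c)) + norm (g (Complex x (- c))))
      + integral {-c..c} (\<lambda>y. norm (g (Complex a y)) + norm (g (Complex (- a) y))))"

(* A function analytic in the open strip need not have values on the boundary lines.
   As usual in the Sinc literature (Stenger), the integral of |g(z)| |dz| over the boundary of
   the strip is the limit of the integrals over the boundaries of the exhausting rectangles. *)
definition has_N1 :: "(complex \<Rightarrow> complex) \<Rightarrow> real \<Rightarrow> real \<Rightarrow> bool" where
  "has_N1 g d L \<longleftrightarrow> (box_boundary_integral g d \<longlongrightarrow> L) (at_right 0)"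

definition B_space :: "real \<Rightarrow> (complex \<Rightarrow> complex) set" where
  "B_space d = {g. g analytic_on strip d \<and> (\<exists>L. has_N1 g d L)}"

(* Error norms of the rules with N = 2n+1 points; the suprema are taken in the extended
   nonnegative reals, so that an unbounded error gives \<infinity>. *)

definition trapezoidal_error ::
    "nat \<Rightarrow> real \<Rightarrow> real \<Rightarrow> (complex \<Rightarrow> complex) \<Rightarrow> ennreal" where
  "trapezoidal_error n h d \<omega> =
     (SUP g\<in>H_unit_ball d \<omega>.
        ennreal (norm ((LBINT x. g (of_real x))
          - of_real h * (\<Sum>k\<in>{- int n..int n}. g (of_real (of_int k * h))))))"

definition Sinc_fun :: "int \<Rightarrow> real \<Rightarrow> real \<Rightarrow> real" where
  "Sinc_fun j h x = sinc (pi * (x / h - of_int j))"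

definition sinc_error ::
    "nat \<Rightarrow> real \<Rightarrow> real \<Rightarrow> (complex \<Rightarrow> complex) \<Rightarrow> ennreal" where
  "sinc_error n h d \<omega> =
     (SUP g\<in>H_unit_ball d \<omega>. SUP x::real.
        ennreal (norm (g (of_real x)
          - (\<Sum>j\<in>{- int n..int n}. g (of_real (of_int j * h)) * of_real (Sinc_fun j h x)))))"

definition admissible_with ::
    "(complex \<Rightarrow> complex) \<Rightarrow> (complex \<Rightarrow> complex) \<Rightarrow> real \<Rightarrow> (complex \<Rightarrow> complex)
      \<Rightarrow> real \<Rightarrow> real \<Rightarrow> real \<Rightarrow> real \<Rightarrow> real \<Rightarrow> bool" where
  "admissible_with f \<phi> d \<omega> \<alpha>1 \<alpha>2 \<beta>1 \<beta>2 \<gamma> \<longleftrightarrow>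
     d > 0 \<and> \<alpha>1 > 0 \<and> \<alpha>2 > 0 \<and> \<beta>1 > 0 \<and> \<beta>2 > 0 \<and> \<gamma> > 0 \<and>
     \<phi> analytic_on strip d \<and>
     (\<lambda>z. f (\<phi> z) * deriv \<phi> z) \<in> H_infty d \<omega> \<and>
     \<omega> \<in> B_space d \<and>
     (\<forall>z\<in>strip d. \<omega> z \<noteq> 0) \<and>
     (\<forall>x::real. \<omega> (of_real x) \<in> \<real>) \<and>
     (\<forall>x::real. \<alpha>1 * exp (- \<beta>1 * exp (\<gamma> * \<bar>x\<bar>)) \<le> norm (\<omega> (of_real x)) \<and>
                norm (\<omega> (of_real x)) \<le> \<alpha>2 * exp (- \<beta>2 * exp (\<gamma> * \<bar>x\<bar>)))"

definition Phi_ad :: "(complex \<Rightarrow> complex) \<Rightarrow> (complex \<Rightarrow> complex) set" where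
  "Phi_ad f = {\<phi>. \<exists>d \<omega> \<alpha>1 \<alpha>2 \<beta>1 \<beta>2 \<gamma>. admissible_with f \<phi> d \<omega> \<alpha>1 \<alpha>2 \<beta>1 \<beta>2 \<gamma>}"

definition Phi_as_ad :: "(complex \<Rightarrow> complex) \<Rightarrow> (complex \<Rightarrow> complex) set" where
  "Phi_as_ad f = {\<phi> \<in> Phi_ad f. \<exists>d \<omega> \<alpha>1 \<alpha>2 \<beta>1 \<beta>2 \<gamma>.
     admissible_with f \<phi> d \<omega> \<alpha>1 \<alpha>2 \<beta>1 \<beta>2 \<gamma> \<and> d * \<gamma> = pi / 2}"

end

theory Submission
  imports Defs "HOL-Probability.Distributions"
begin

text \<open>
  Both rules are infinite sampling sums cut off at \<open>\<bar>k\<bar> \<le> n\<close>, so the error splits into the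
  discretisation error of the infinite sum and the truncation error.  The mesh size is chosen to
  balance the two.

  For the discretisation error, multiply \<open>g\<close> by a kernel that has simple poles at the nodes \<open>k h\<close>,
  and integrate around the boundary of a rectangle that exhausts the strip.  The residues give the
  sampling sum.  On the horizontal sides, close to \<open>\<bar>Im z\<bar> = d\<close>, the kernel is at most of order
  \<open>1 / (d sinh (\<pi> d / h))\<close> for the Sinc approximation (lemma \<open>sinc_error_box\<close>).  For the
  trapezoidal rule it differs from 0 on the upper side and from 1 on the lower side by about
  \<open>exp (- 2 \<pi> d / h)\<close>, and the 1 accounts for the integral that the rule approximates (lemma
  \<open>trapezoidal_error_box\<close>).  As
  \<open>\<bar>g\<bar> \<le> \<bar>\<omega>\<bar>\<close>, what remains is the boundary integral \<open>L\<close> of \<open>\<bar>\<omega>\<bar>\<close>, the same for all \<open>g\<close> in the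
  unit ball.

  The existence of \<open>L\<close> only says that the integrals of \<open>\<bar>\<omega>\<bar>\<close> over the rectangle boundaries converge
  as a whole; it does not give separately that the vertical sides contribute less and less.  In the
  Sinc case the kernel decays like the inverse of the half-width on these sides, which is enough.
  In the trapezoidal case the kernel is merely bounded there, and \<open>g\<close> is therefore replaced by
  \<open>g(z) exp (- z\<^sup>2 / A)\<close> on the rectangle of half-width \<open>A\<close>: the factor is exponentially small
  in \<open>A\<close> on the vertical sides, at most \<open>exp (d\<^sup>2 / A)\<close> on the horizontal ones, and tends to 1
  pointwise, so that one limit \<open>A \<rightarrow> \<infinity>\<close> removes the vertical sides and the regularisation
  together (lemmas \<open>trapezoidal_error_le\<close> and \<open>sinc_error_le\<close>).

  The truncation error is controlled on the real line alone: the sum of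
  \<open>exp (- \<beta> exp (\<gamma> k h))\<close> over \<open>k > n\<close> is dominated by a geometric series and is at most
  \<open>exp (- X) / (X \<gamma> h)\<close> with \<open>X = \<beta> exp (\<gamma> n h)\<close> (lemma \<open>double_exponential_tail\<close>).

  Put \<open>P = \<pi>\<^sup>2\<close> for the trapezoidal rule and \<open>P = \<pi>\<^sup>2 / 2\<close> for the Sinc approximation.  With
  \<open>d \<gamma> = \<pi> / 2\<close> and \<open>\<gamma> n h = ln (P n / \<beta>)\<close>, the discretisation error is of order
  \<open>exp (- P n / ln (P n / \<beta>))\<close> and the truncation error of order \<open>exp (- P n)\<close>.  The bound to be
  proved is the first of these with \<open>n + 1/2 = N / 2\<close> in place of \<open>n\<close>; the shift, and the finitely
  many \<open>n\<close> for which the logarithm is small, cost only a constant factor (lemma \<open>mesh_rates\<close>).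
\<close>

section \<open>Residues on rectangles\<close>

lemma contour_integral_linepath_horizontal:
  assumes "p < q"
  shows "contour_integral (linepath (Complex p b) (Complex q b)) f = integral {p..q} (\<lambda>x. f (Complex x b))"
proof -
  let ?z = "Complex p b" and ?z' = "Complex q b"
  have "contour_integral (linepath ?z ?z') f =
         (?z' - ?z) * integral {0..1} (\<lambda>x. f (linepath ?z ?z' x))"
    by (simp add: contour_integral_integral)
  also have "?z' - ?z = of_real (q - p)"
    by (simp add: complex_eq_iff)
  also have "(\<lambda>x. f (linepath ?z ?z' x)) = (\<lambda>x. f (Complex (p + (q - p) * x) b))"
    by (intro ext arg_cong[of _ _ f]) (simp add: linepath_def complex_eq_iff algebra_simps)
  also have "{0..1} = (\<lambda>x. x / (q - p)) ` {0..q - p}"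
    using assms by simp
  also have "integral \<dots> (\<lambda>x. f (Complex (p + (q - p) * x) b)) =
             integral {p-p..q-p} (\<lambda>x. f (Complex (x + p) b)) / of_real (q - p)"
    using assms by (subst integral_stretch_real) (auto simp: scaleR_conv_of_real add_ac)
  also have "\<dots> = integral {p..q} (\<lambda>x. f (Complex x b)) / of_real (q - p)"
    by (subst integral_shift_real_ivl) (rule refl)
  finally show ?thesis
    using assms by simp
qed

text \<open>
  Estimates on the sides are easier for integrals over real intervals than for contour integrals.
  The top side and the left side are traversed backwards, hence the differences.
\<close>

lemma contour_integral_rectpath:
  assumes "0 < a" "b1 < b2"
    and cont: "continuous_on (path_image (rectpath (Complex (-a) b1) (Complex a b2))) F"
  shows "contour_integral (rectpath (Complex (-a) b1) (Complex a b2)) F =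
      (integral {-a..a} (\<lambda>x. F (Complex x b1)) - integral {-a..a} (\<lambda>x. F (Complex x b2)))
      + \<i> * (integral {b1..b2} (\<lambda>y. F (Complex a y)) - integral {b1..b2} (\<lambda>y. F (Complex (-a) y)))"
proof -
  let ?A = "Complex (-a) b1" and ?B = "Complex a b1" and ?C = "Complex a b2" and ?D = "Complex (-a) b2"
  have img: "path_image (rectpath ?A ?C) =
      closed_segment ?A ?B \<union> closed_segment ?B ?C \<union> closed_segment ?C ?D \<union> closed_segment ?D ?A"
    by (simp add: rectpath_def Let_def path_image_join Un_assoc)
  have int: "F contour_integrable_on linepath ?A ?B" "F contour_integrable_on linepath ?B ?C"
    "F contour_integrable_on linepath ?C ?D" "F contour_integrable_on linepath ?D ?A"
    by (intro contour_integrable_continuous_linepath continuous_on_subset[OF cont];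
        use img in blast)+
  have "contour_integral (rectpath ?A ?C) F =
      contour_integral (linepath ?A ?B) F + contour_integral (linepath ?B ?C) F
      + contour_integral (linepath ?C ?D) F + contour_integral (linepath ?D ?A) F"
    using int by (simp add: rectpath_def Let_def)
  also have "contour_integral (linepath ?C ?D) F = - contour_integral (linepath ?D ?C) F"
    by (intro contour_integral_reverse_linepath continuous_on_subset[OF cont])
      (use img in blast)
  also have "contour_integral (linepath ?D ?A) F = - contour_integral (linepath ?A ?D) F"
    by (intro contour_integral_reverse_linepath continuous_on_subset[OF cont])
      (use img in blast)
  finally show ?thesis
    using assms(1,2) contour_integral_linepath_same_Re[of ?B a ?C b1 b2 F]
      contour_integral_linepath_same_Re[of ?A "-a" ?D b1 b2 F]
    by (simp add: contour_integral_linepath_horizontal algebra_simps)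
qed

text \<open>
  The residue theorem needs finitely many poles in the domain of holomorphy.  The larger box of
  half-width \<open>a'\<close> serves as that domain: the kernels below have infinitely many poles in the strip,
  but those in the larger box are already inside the contour.
\<close>

lemma box_integral_simple_poles:
  fixes F :: "complex \<Rightarrow> complex"
  assumes "0 < a" "a < a'" "0 < c" "c < d" "finite P"
    and P: "P \<subseteq> box (Complex (-a) (-c)) (Complex a c)"
    and holo: "F holomorphic_on box (Complex (-a') (-d)) (Complex a' d) - P"
    and lim: "\<And>p. p \<in> P \<Longrightarrow> ((\<lambda>w. F w * (w - p)) \<longlongrightarrow> r p) (at p)"
  shows "(integral {-a..a} (\<lambda>x. F (Complex x (-c))) - integral {-a..a} (\<lambda>x. F (Complex x c)))
      + \<i> * (integral {-c..c} (\<lambda>y. F (Complex a y)) - integral {-c..c} (\<lambda>y. F (Complex (-a) y)))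
      = 2 * pi * \<i> * (\<Sum>p\<in>P. r p)"
proof -
  let ?S = "box (Complex (-a') (-d)) (Complex a' d)"
  let ?R = "rectpath (Complex (-a) (-c)) (Complex a c)"
  have cbox: "cbox (Complex (-a) (-c)) (Complex a c) \<subseteq> ?S"
    using assms(1-4) by (auto simp: in_cbox_complex_iff in_box_complex_iff)
  have img: "path_image ?R = cbox (Complex (-a) (-c)) (Complex a c) - box (Complex (-a) (-c)) (Complex a c)"
    using assms(1-4) by (intro path_image_rectpath_cbox_minus_box) auto
  have PS: "P \<subseteq> ?S"
    using P box_subset_cbox cbox by (meson subset_trans)
  have res: "residue F p = r p" if "p \<in> P" for p
  proof (rule residue_simple'[where s = "?S - (P - {p})"])
    show "open (?S - (P - {p}))"
      using \<open>finite P\<close> by (intro open_Diff open_box finite_imp_closed) auto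
    show "p \<in> ?S - (P - {p})" using that PS by auto
    have "?S - (P - {p}) - {p} = ?S - P" using that by auto
    then show "F holomorphic_on ?S - (P - {p}) - {p}" using holo by simp
    show "((\<lambda>w. F w * (w - p)) \<longlongrightarrow> r p) (at p)" by (rule lim[OF that])
  qed
  have "contour_integral ?R F = 2 * pi * \<i> * (\<Sum>p\<in>P. winding_number ?R p * residue F p)"
  proof (rule Residue_theorem[where S = ?S])
    show "path_image ?R \<subseteq> ?S - P" using img cbox P by blast
    show "\<forall>z. z \<notin> ?S \<longrightarrow> winding_number ?R z = 0"
      using assms(1-4) cbox by (intro allI impI winding_number_rectpath_outside) auto
  qed (use assms holo in \<open>auto intro: convex_connected\<close>)
  also have "(\<Sum>p\<in>P. winding_number ?R p * residue F p) = (\<Sum>p\<in>P. r p)"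
    using P by (intro sum.cong refl) (auto simp: res winding_number_rectpath)
  finally have "contour_integral ?R F = 2 * pi * \<i> * (\<Sum>p\<in>P. r p)" .
  moreover have "continuous_on (path_image ?R) F"
    using img cbox P
    by (intro holomorphic_on_imp_continuous_on holomorphic_on_subset[OF holo]) blast
  ultimately show ?thesis
    using assms(1,3) by (subst (asm) contour_integral_rectpath) auto
qed

text \<open>
  The limit form of the residue of \<open>G / \<phi>\<close> at a simple zero of \<open>\<phi>\<close>.  Since \<open>G p = 0\<close> may occur
  (a function can vanish at a node), the point need not be a pole, and a formula based on the pole
  order would not apply.
\<close>

lemma simple_pole_limit:
  fixes G \<phi> :: "complex \<Rightarrow> complex"
  assumes "isCont G p" "(\<phi> has_field_derivative D) (at p)" "\<phi> p = 0" "D \<noteq> 0"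
  shows "((\<lambda>w. G w / \<phi> w * (w - p)) \<longlongrightarrow> G p / D) (at p)"
proof -
  have "((\<lambda>w. \<phi> w / (w - p)) \<longlongrightarrow> D) (at p)"
    using assms(2,3) by (simp add: has_field_derivative_iff)
  then have "((\<lambda>w. G w / (\<phi> w / (w - p))) \<longlongrightarrow> G p / D) (at p)"
    using assms(1,4) by (intro tendsto_divide) (auto simp: isCont_def)
  then show ?thesis by simp
qed

lemma strip_eq: "strip d = {z. - d < Im z} \<inter> {z. Im z < d}"
  by (auto simp: strip_def)

lemma open_strip: "open (strip d)"
  unfolding strip_eq by (intro open_Int open_halfspace_Im_gt open_halfspace_Im_lt)

lemma convex_strip: "convex (strip d)"
  unfolding strip_eq by (intro convex_Int convex_halfspace_Im_gt convex_halfspace_Im_lt)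

lemma analytic_on_strip: "f analytic_on strip d \<longleftrightarrow> f holomorphic_on strip d"
  by (simp add: analytic_on_open open_strip)

lemma norm_sin_ge_sinh:
  fixes z :: complex shows "sinh \<bar>Im z\<bar> \<le> norm (sin z)"
proof (rule power2_le_imp_le)
  define u where "u = exp (Im z)"
  have "u > 0" by (simp add: u_def)
  have "(sinh \<bar>Im z\<bar>)\<^sup>2 = (sinh (Im z))\<^sup>2" by (auto simp: abs_if)
  also have "\<dots> = ((u - inverse u) / 2)\<^sup>2"
    by (simp add: sinh_def exp_minus u_def)
  also have "\<dots> = (u\<^sup>2 + inverse (u\<^sup>2) - 2) / 4"
    using \<open>u > 0\<close> by (simp add: power2_eq_square field_simps)
  also have "\<dots> = (exp (2 * Im z) + inverse (exp (2 * Im z)) - 2) / 4"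
    by (simp add: u_def exp_double)
  also have "\<dots> \<le> (norm (sin z))\<^sup>2"
    unfolding norm_sin_squared by (intro divide_right_mono diff_left_mono) auto
  finally show "(sinh \<bar>Im z\<bar>)\<^sup>2 \<le> (norm (sin z))\<^sup>2" .
qed simp

text \<open>
  The vertical sides of the rectangles run half-way between two nodes; there \<open>\<bar>sin\<bar>\<close> equals
  \<open>cosh (Im z)\<close>.
\<close>

lemma norm_sin_ge_1:
  fixes z :: complex assumes "cos (2 * Re z) = -1" shows "1 \<le> norm (sin z)"
proof (rule power2_le_imp_le)
  define t where "t = exp (2 * Im z)"
  have "t > 0" by (simp add: t_def)
  then have "t + inverse t - 2 = (t - 1)\<^sup>2 / t"
    by (simp add: field_simps power2_eq_square)
  then have "t + inverse t \<ge> 2" using \<open>t > 0\<close> 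
    by (smt (verit) divide_nonneg_nonneg zero_le_power2)
  then show "1\<^sup>2 \<le> (norm (sin z))\<^sup>2"
    unfolding norm_sin_squared by (simp add: assms flip: t_def)
qed simp

section \<open>The discretisation error on a finite rectangle\<close>

lemma Complex_in_strip: "Complex x y \<in> strip d \<longleftrightarrow> \<bar>y\<bar> < d"
  by (simp add: strip_def)

lemma continuous_on_along_horizontal:
  assumes "continuous_on A g" "\<And>x. x \<in> S \<Longrightarrow> Complex x y \<in> A"
  shows "continuous_on S (\<lambda>x. g (Complex x y))"
  by (rule continuous_on_compose2[OF assms(1)])
    (use assms(2) in \<open>auto simp: Complex_eq intro!: continuous_intros\<close>)

lemma continuous_on_along_vertical:
  assumes "continuous_on A g" "\<And>y. y \<in> S \<Longrightarrow> Complex x y \<in> A"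
  shows "continuous_on S (\<lambda>y. g (Complex x y))"
  by (rule continuous_on_compose2[OF assms(1)])
    (use assms(2) in \<open>auto simp: Complex_eq intro!: continuous_intros\<close>)

lemma continuous_on_along_reals:
  assumes "continuous_on (strip d) g" "0 < d"
  shows "continuous_on S (\<lambda>x. g (of_real x))"
  by (rule continuous_on_compose2[OF assms(1)])
    (use assms(2) in \<open>auto simp: strip_def intro!: continuous_intros\<close>)

lemma norm_integral_diff_le:
  fixes u v :: "real \<Rightarrow> complex"
  assumes "continuous_on {p..q} u" "continuous_on {p..q} v"
    and "continuous_on {p..q} U" "continuous_on {p..q} V"
    and "\<And>x. x \<in> {p..q} \<Longrightarrow> norm (u x) \<le> U x" "\<And>x. x \<in> {p..q} \<Longrightarrow> norm (v x) \<le> V x"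
  shows "norm (integral {p..q} u - integral {p..q} v) \<le> integral {p..q} (\<lambda>x. U x + V x)"
proof -
  have "integral {p..q} u - integral {p..q} v = integral {p..q} (\<lambda>x. u x - v x)"
    using assms by (simp add: Henstock_Kurzweil_Integration.integral_diff integrable_continuous_interval)
  also have "norm \<dots> \<le> integral {p..q} (\<lambda>x. U x + V x)"
  proof (rule integral_norm_bound_integral)
    show "norm (u x - v x) \<le> U x + V x" if "x \<in> {p..q}" for x
      using norm_triangle_ineq4[of "u x" "v x"] assms(5,6)[OF that] by linarith
  qed (use assms in \<open>auto intro!: integrable_continuous_interval continuous_intros\<close>)
  finally show ?thesis .
qed

lemma exp_neg_2pi_mesh:
  assumes "h > 0"
  shows "norm (exp (- (2 * pi * \<i> / of_real h * z))) = exp (2 * pi * Im z / h)"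
  by (simp add: norm_exp_eq_Re Re_divide_of_real)

text \<open>
  The kernel is \<open>1 / \<phi>\<close> with \<open>\<phi> z = 1 - exp (- 2 \<pi> i z / h)\<close>, whose residue at every node
  is \<open>h / (2 \<pi> i)\<close>.  It is exponentially small in the upper half plane, but close to 1 in the lower
  one.  There \<open>1 / \<phi> - 1\<close> is small, and the subtracted 1 is exactly what produces the integral over
  the real line, by Cauchy's theorem on the lower half of the rectangle.  The factor 2 on the vertical
  sides comes from their lower halves being used twice.
\<close>

lemma trapezoidal_error_box:
  fixes g :: "complex \<Rightarrow> complex" and M :: nat
  assumes holo: "g holomorphic_on strip d" and c: "0 < c" "c < d" and h: "h > 0"
  defines "a \<equiv> (real M + 1/2) * h"
  shows "norm (integral {-a..a} (\<lambda>x. g (of_real x))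
            - of_real h * (\<Sum>k\<in>{- int M..int M}. g (of_real (of_int k * h))))
      \<le> integral {-a..a} (\<lambda>x. norm (g (Complex x c)) + norm (g (Complex x (- c)))) / (exp (2 * pi * c / h) - 1)
        + 2 * integral {-c..c} (\<lambda>y. norm (g (Complex a y)) + norm (g (Complex (- a) y)))"
proof -
  define w where "w = 2 * pi * \<i> / of_real h"
  define \<phi> where "\<phi> = (\<lambda>z. 1 - exp (- (w * z)))"
  define F where "F = (\<lambda>z. g z / \<phi> z)"
  define K where "K = {- int M..int M}"
  define P where "P = (\<lambda>k. of_real (of_int k * h) :: complex) ` K"
  \<comment> \<open>Any factor strictly between \<open>M + 1/2\<close> and \<open>M + 1\<close> would do: no further node is reached.\<close>
  define a' where "a' = (real M + 3/4) * h"
  define E where "E = exp (2 * pi * c / h)"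
  have a: "0 < a" "a < a'" using h by (auto simp: a_def a'_def)
  have E: "E > 1" using c h by (simp add: E_def)
  have w0: "w \<noteq> 0" using h by (simp add: w_def)
  have norm_e: "norm (exp (- (w * z))) = exp (2 * pi * Im z / h)" for z
    using exp_neg_2pi_mesh[OF h, of z] by (simp add: w_def)
  have zero: "\<exists>k. z = of_real (of_int k * h)" if "\<phi> z = 0" for z
  proof -
    have "exp (- (w * z)) = 1" using that by (simp add: \<phi>_def)
    then obtain n :: int where n: "Re (- (w * z)) = 0" "Im (- (w * z)) = of_int (2 * n) * pi"
      by (auto simp: exp_eq_1)
    have "Im z = 0" using n(1) h by (simp add: w_def Re_divide_of_real)
    moreover have "pi * (- Re z) = pi * (of_int n * h)"
      using n(2) h by (simp add: w_def Im_divide_of_real field_simps)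
    then have "Re z = of_int (- n) * h"
      by (subst (asm) mult_left_cancel) auto
    ultimately have "z = of_real (of_int (- n) * h)" by (simp add: complex_eq_iff)
    then show ?thesis by blast
  qed
  have exp_node: "exp (- (w * of_real (of_int k * h))) = 1" for k :: int
  proof -
    have e: "- (w * of_real (of_int k * h)) = of_real (2 * of_int (- k) * pi) * \<i>"
      using h by (simp add: w_def)
    show ?thesis
      unfolding e exp_eq_1 by (auto intro!: exI[of _ "- k"])
  qed
  have holoF: "F holomorphic_on box (Complex (-a') (-d)) (Complex a' d) - P"
  proof -
    have "\<phi> z \<noteq> 0" if "z \<in> box (Complex (-a') (-d)) (Complex a' d) - P" for z
    proof
      assume "\<phi> z = 0"
      then obtain k where k: "z = of_real (of_int k * h)" using zero by blast
      have "\<bar>of_int k * h\<bar> < a'" using that k by (auto simp: in_box_complex_iff)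
      then have "\<bar>of_int k\<bar> < real M + 3/4" using h by (simp add: a'_def abs_mult)
      then have "\<bar>k\<bar> \<le> int M" by linarith
      then have "k \<in> K" by (auto simp: K_def)
      then show False using that k by (auto simp: P_def)
    qed
    moreover have "box (Complex (-a') (-d)) (Complex a' d) - P \<subseteq> strip d"
      by (auto simp: in_box_complex_iff strip_def)
    ultimately show ?thesis
      unfolding F_def using \<phi>_def
      by (auto intro!: holomorphic_intros intro: holomorphic_on_subset[OF holo])
  qed
  have gcont: "isCont g z" if "z \<in> strip d" for z
    using holo that open_strip continuous_on_eq_continuous_at holomorphic_on_imp_continuous_on by blast
  have PR: "P \<subseteq> box (Complex (-a) (-c)) (Complex a c)"
  proof -
    have "\<bar>of_int k * h\<bar> < a" if "k \<in> K" for k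
    proof -
      have "\<bar>k\<bar> \<le> int M" using that by (auto simp: K_def)
      then have "\<bar>of_int k\<bar> < real M + 1/2" by linarith
      then show ?thesis using h by (simp add: a_def abs_mult)
    qed
    then show ?thesis using c by (fastforce simp: P_def in_box_complex_iff abs_less_iff)
  qed
  have lim: "((\<lambda>z. F z * (z - p)) \<longlongrightarrow> g p / w) (at p)" if "p \<in> P" for p
  proof -
    obtain k where p: "p = of_real (of_int k * h)" using \<open>p \<in> P\<close> by (auto simp: P_def)
    have e: "exp (- (w * p)) = 1" unfolding p by (rule exp_node)
    have "(\<phi> has_field_derivative w) (at p)"
      unfolding \<phi>_def by (auto intro!: derivative_eq_intros simp: e)
    moreover have "\<phi> p = 0" by (simp add: \<phi>_def e)
    moreover have "p \<in> strip d" using c by (auto simp: p strip_def)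
    ultimately show ?thesis
      unfolding F_def using w0 gcont by (intro simple_pole_limit) auto
  qed
  have "(integral {-a..a} (\<lambda>x. F (Complex x (-c))) - integral {-a..a} (\<lambda>x. F (Complex x c)))
      + \<i> * (integral {-c..c} (\<lambda>y. F (Complex a y)) - integral {-c..c} (\<lambda>y. F (Complex (-a) y)))
      = 2 * pi * \<i> * (\<Sum>p\<in>P. g p / w)"
    by (rule box_integral_simple_poles[OF a c _ PR holoF lim]) (auto simp: P_def K_def)
  also have "(\<Sum>p\<in>P. g p / w) = (\<Sum>k\<in>K. g (of_real (of_int k * h)) / w)"
    unfolding P_def using h by (subst sum.reindex) (auto simp: inj_on_def)
  also have "2 * pi * \<i> * \<dots> = of_real h * (\<Sum>k\<in>K. g (of_real (of_int k * h)))"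
    using h by (simp add: w_def sum_distrib_left mult.commute)
  finally have full: "(integral {-a..a} (\<lambda>x. F (Complex x (-c))) - integral {-a..a} (\<lambda>x. F (Complex x c)))
      + \<i> * (integral {-c..c} (\<lambda>y. F (Complex a y)) - integral {-c..c} (\<lambda>y. F (Complex (-a) y)))
      = of_real h * (\<Sum>k\<in>K. g (of_real (of_int k * h)))" .
  have g_on: "continuous_on (strip d) g"
    using holo by (rule holomorphic_on_imp_continuous_on)
  have half: "(integral {-a..a} (\<lambda>x. g (Complex x (-c))) - integral {-a..a} (\<lambda>x. g (Complex x 0)))
      + \<i> * (integral {-c..0} (\<lambda>y. g (Complex a y)) - integral {-c..0} (\<lambda>y. g (Complex (-a) y))) = 0"
  proof -
    let ?R = "rectpath (Complex (-a) (-c)) (Complex a 0)"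
    have img: "path_image ?R \<subseteq> strip d"
      by (rule order_trans[OF path_image_rectpath_subset_cbox])
        (use a c in \<open>auto simp: in_cbox_complex_iff strip_def\<close>)
    have "contour_integral ?R g = 0"
      by (rule contour_integral_unique[OF Cauchy_theorem_convex_simple[OF holo convex_strip _ img]]) auto
    then show ?thesis
      using a c continuous_on_subset[OF g_on img] by (subst (asm) contour_integral_rectpath) auto
  qed
  \<comment> \<open>Half-way between two nodes the exponential is a negative real number.\<close>
  have side: "\<phi> (Complex x y) \<noteq> 0 \<and> norm (\<phi> (Complex x y)) \<ge> 1" if "\<bar>x\<bar> = a" for x y
  proof -
    have c1: "cos (2 * pi * a / h) = - 1"
    proof -
      have "2 * pi * a / h = real (2 * M + 1) * pi"
        using h by (simp add: a_def field_simps)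
      then show ?thesis by (simp only: cos_npi) simp
    qed
    have "cos (2 * pi * x / h) = cos (2 * pi * a / h)"
      using that a by (auto simp: abs_if split: if_splits)
    then have "Re (exp (- (w * Complex x y))) = - exp (2 * pi * y / h)"
      using c1 by (simp add: w_def Re_exp Re_divide_of_real Im_divide_of_real)
    then have "1 \<le> Re (\<phi> (Complex x y))" by (simp add: \<phi>_def)
    then show ?thesis using complex_Re_le_cmod[of "\<phi> (Complex x y)"] by force
  qed
  have top: "\<phi> (Complex x c) \<noteq> 0" "norm (1 / \<phi> (Complex x c)) \<le> 1 / (E - 1)" for x
  proof -
    have "E - 1 \<le> norm (\<phi> (Complex x c))"
      using norm_triangle_ineq3[of "exp (- (w * Complex x c))" 1] norm_e[of "Complex x c"]
      by (simp add: \<phi>_def E_def norm_minus_commute)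
    then show "\<phi> (Complex x c) \<noteq> 0" "norm (1 / \<phi> (Complex x c)) \<le> 1 / (E - 1)"
      using E by (auto simp: norm_divide intro!: divide_left_mono mult_pos_pos)
  qed
  have bot: "\<phi> (Complex x (-c)) \<noteq> 0" "norm (1 - 1 / \<phi> (Complex x (-c))) \<le> 1 / (E - 1)" for x
  proof -
    let ?e = "exp (- (w * Complex x (-c)))"
    have n: "norm ?e = 1 / E"
      using norm_e[of "Complex x (-c)"] by (simp add: E_def exp_minus field_simps)
    have le: "1 - 1 / E \<le> norm (\<phi> (Complex x (-c)))"
      using norm_triangle_ineq2[of 1 ?e] n by (simp add: \<phi>_def)
    have pos: "0 < 1 - 1 / E" using E by simp
    show nz: "\<phi> (Complex x (-c)) \<noteq> 0" using le pos by auto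
    have "1 - 1 / \<phi> (Complex x (-c)) = - ?e / \<phi> (Complex x (-c))"
      using nz by (simp add: field_simps \<phi>_def)
    then have "norm (1 - 1 / \<phi> (Complex x (-c))) = (1 / E) / norm (\<phi> (Complex x (-c)))"
      using n by (simp add: norm_divide)
    also have "\<dots> \<le> (1 / E) / (1 - 1 / E)"
      using le pos E by (intro divide_left_mono mult_pos_pos) auto
    also have "\<dots> = 1 / (E - 1)" using E by (simp add: field_simps)
    finally show "norm (1 - 1 / \<phi> (Complex x (-c))) \<le> 1 / (E - 1)" .
  qed
  have hc: "continuous_on S (\<lambda>x. g (Complex x y))" if "\<bar>y\<bar> < d" for S y
    using that by (intro continuous_on_along_horizontal[OF g_on]) (simp add: Complex_in_strip)
  have vc: "continuous_on {-c..q} (\<lambda>y. g (Complex x y))" if "q \<le> c" for x q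
    using that c by (intro continuous_on_along_vertical[OF g_on]) (auto simp: Complex_in_strip abs_less_iff)
  have \<phi>h: "continuous_on S (\<lambda>x. \<phi> (Complex x y))" for S y
    unfolding \<phi>_def by (auto simp: Complex_eq intro!: continuous_intros)
  have \<phi>v: "continuous_on S (\<lambda>y. \<phi> (Complex x y))" for S x
    unfolding \<phi>_def by (auto simp: Complex_eq intro!: continuous_intros)
  define H where "H = integral {-a..a} (\<lambda>x. norm (g (Complex x c)) + norm (g (Complex x (- c))))"
  define V where "V = integral {-c..c} (\<lambda>y. norm (g (Complex a y)) + norm (g (Complex (- a) y)))"
  \<comment> \<open>The terms of the contour integral, with the 1 split off from the kernel on the lower side.\<close>
  define T where "T = integral {-a..a} (\<lambda>x. F (Complex x c))
      - integral {-a..a} (\<lambda>x. F (Complex x (-c)) - g (Complex x (-c)))"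
  define V1 where "V1 = integral {-c..c} (\<lambda>y. F (Complex a y)) - integral {-c..c} (\<lambda>y. F (Complex (-a) y))"
  define V0 where "V0 = integral {-c..0} (\<lambda>y. g (Complex a y)) - integral {-c..0} (\<lambda>y. g (Complex (-a) y))"
  have "norm T \<le> integral {-a..a} (\<lambda>x. norm (g (Complex x c)) / (E - 1) + norm (g (Complex x (- c))) / (E - 1))"
    unfolding T_def F_def
  proof (rule norm_integral_diff_le)
    show "norm (g (Complex x c) / \<phi> (Complex x c)) \<le> norm (g (Complex x c)) / (E - 1)" for x
      using mult_left_mono[OF top(2), of "norm (g (Complex x c))" x] by (simp add: norm_divide)
    show "norm (g (Complex x (-c)) / \<phi> (Complex x (-c)) - g (Complex x (-c))) \<le> norm (g (Complex x (-c))) / (E - 1)" for x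
    proof -
      have "g (Complex x (-c)) / \<phi> (Complex x (-c)) - g (Complex x (-c))
          = - (g (Complex x (-c)) * (1 - 1 / \<phi> (Complex x (-c))))" by (simp add: algebra_simps)
      then show ?thesis
        using mult_left_mono[OF bot(2), of "norm (g (Complex x (-c)))" x] by (simp add: norm_mult)
    qed
  qed (use c E top(1) bot(1) in \<open>auto intro!: continuous_intros hc \<phi>h\<close>)
  also have "\<dots> = H / (E - 1)"
    unfolding H_def by (simp flip: add_divide_distrib)
  finally have nT: "norm T \<le> H / (E - 1)" .
  have nV1: "norm V1 \<le> V"
    unfolding V1_def V_def F_def
  proof (rule norm_integral_diff_le)
    have "norm (u / \<phi> (Complex x y)) \<le> norm u" if "\<bar>x\<bar> = a" for x y u
    proof -
      have "norm u \<le> norm u * norm (\<phi> (Complex x y))"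
        using side[OF that, of y] by (simp add: mult_le_cancel_left1)
      then show ?thesis using side[OF that, of y] by (simp add: norm_divide divide_le_eq)
    qed
    then show "norm (g (Complex a y) / \<phi> (Complex a y)) \<le> norm (g (Complex a y))"
      "norm (g (Complex (-a) y) / \<phi> (Complex (-a) y)) \<le> norm (g (Complex (-a) y))" for y
      using a by auto
  qed (use c side a in \<open>auto intro!: continuous_intros vc \<phi>v\<close>)
  have "norm V0 \<le> integral {-c..0} (\<lambda>y. norm (g (Complex a y)) + norm (g (Complex (- a) y)))"
    unfolding V0_def by (rule norm_integral_diff_le) (use c in \<open>auto intro!: continuous_intros vc\<close>)
  also have "\<dots> \<le> V"
    unfolding V_def
    by (rule integral_subset_le)
      (use c in \<open>auto intro!: integrable_continuous_interval continuous_intros vc\<close>)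
  finally have nV0: "norm V0 \<le> V" .
  have "integral {-a..a} (\<lambda>x. F (Complex x (-c)) - g (Complex x (-c)))
      = integral {-a..a} (\<lambda>x. F (Complex x (-c))) - integral {-a..a} (\<lambda>x. g (Complex x (-c)))"
    unfolding F_def using c bot(1)
    by (intro Henstock_Kurzweil_Integration.integral_diff integrable_continuous_interval)
      (auto intro!: continuous_intros hc \<phi>h)
  moreover have "integral {-a..a} (\<lambda>x. g (Complex x 0))
      = integral {-a..a} (\<lambda>x. g (Complex x (-c))) + \<i> * V0"
    using half unfolding V0_def[symmetric] by (simp add: algebra_simps)
  moreover have "of_real h * (\<Sum>k\<in>K. g (of_real (of_int k * h)))
      = integral {-a..a} (\<lambda>x. F (Complex x (-c))) - integral {-a..a} (\<lambda>x. F (Complex x c)) + \<i> * V1"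
    using full unfolding V1_def by (rule sym)
  ultimately have "integral {-a..a} (\<lambda>x. g (Complex x 0)) - of_real h * (\<Sum>k\<in>K. g (of_real (of_int k * h)))
      = T - \<i> * V1 + \<i> * V0"
    unfolding T_def by (simp only:) (simp add: algebra_simps)
  also have "norm \<dots> \<le> norm T + norm V1 + norm V0"
    using norm_triangle_ineq[of "T - \<i> * V1" "\<i> * V0"] norm_triangle_ineq4[of T "\<i> * V1"]
    by (simp add: norm_mult)
  also have "\<dots> \<le> H / (E - 1) + 2 * V" using nT nV1 nV0 by linarith
  finally show ?thesis
    by (simp add: K_def H_def V_def E_def complex_of_real_def)
qed

lemma sin_int_pi: "sin (of_int k * pi) = 0"
  by (simp add: sin_zero_iff_int2)

lemma cos_int_pi: "cos (of_int k * pi) = (-1) powi k"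
  using cos_npi_int[of k] by (simp add: mult.commute power_int_minus_left)

lemma Sinc_fun_node:
  assumes "h > 0"
  shows "Sinc_fun k h (of_int j * h) = (if j = k then 1 else 0)"
proof -
  have "pi * (of_int j * h / h - of_int k) = of_int (j - k) * pi"
    using assms by simp
  moreover have "sin (of_int (j - k) * pi) = 0"
    by (rule sin_int_pi)
  ultimately show ?thesis
    by (simp only: Sinc_fun_def) auto
qed

text \<open>
  The kernel is \<open>sin (\<pi> x / h) / ((z - x) sin (\<pi> z / h))\<close>: its pole at \<open>x\<close> gives \<open>g x\<close>, and its
  pole at \<open>k h\<close> gives minus the Sinc function of that node, because
  \<open>sin (\<pi> (x / h - k)) = (-1)\<^sup>k sin (\<pi> x / h)\<close>.  If \<open>x\<close> is a node, the two poles merge; that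
  case is excluded here.
\<close>

lemma sinc_error_box:
  fixes g :: "complex \<Rightarrow> complex" and M :: nat and x :: real
  assumes holo: "g holomorphic_on strip d" and c: "0 < c" "c < d" and h: "h > 0"
    and xa: "\<bar>x\<bar> < (real M + 1/2) * h" and xn: "\<And>k. x \<noteq> of_int k * h"
  defines "a \<equiv> (real M + 1/2) * h"
  shows "norm (g (of_real x) - (\<Sum>k\<in>{- int M..int M}. g (of_real (of_int k * h)) * of_real (Sinc_fun k h x)))
      \<le> (integral {-a..a} (\<lambda>x. norm (g (Complex x c)) + norm (g (Complex x (- c)))) / (c * sinh (pi * c / h))
        + integral {-c..c} (\<lambda>y. norm (g (Complex a y)) + norm (g (Complex (- a) y))) / (a - \<bar>x\<bar>)) / (2 * pi)"
proof -
  define s where "s = (\<lambda>z. sin (of_real (pi / h) * z) :: complex)"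
  define \<psi> where "\<psi> = (\<lambda>z. (z - of_real x) * s z)"
  define F where "F = (\<lambda>z. g z / \<psi> z)"
  define K where "K = {- int M..int M}"
  define P where "P = (\<lambda>k. of_real (of_int k * h) :: complex) ` K"
  \<comment> \<open>Any factor strictly between \<open>M + 1/2\<close> and \<open>M + 1\<close> would do: no further node is reached.\<close>
  define a' where "a' = (real M + 3/4) * h"
  define r where "r = (\<lambda>p. if p = of_real x then g p / s p
      else g p / (p - of_real x) / (of_real (pi / h) * cos (of_real (pi / h) * p)))"
  have xa: "\<bar>x\<bar> < a" using xa by (simp add: a_def)
  have a: "0 < a" "a < a'" using h by (auto simp: a_def a'_def)
  have zero: "\<exists>k. z = of_real (of_int k * h)" if "s z = 0" for z
  proof -
    obtain n :: int where "of_real (pi / h) * z = of_real (of_int n * pi)"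
      using \<open>s z = 0\<close> by (auto simp: s_def sin_eq_0)
    then have "z = of_real (of_int n * h)" using h by (simp add: field_simps)
    then show ?thesis by blast
  qed
  have sx: "s (of_real x) \<noteq> 0" using zero xn of_real_eq_iff by blast
  have xP: "of_real x \<notin> P"
  proof -
    have "complex_of_real x \<noteq> of_real (of_int k * h)" for k
      using xn by (simp only: of_real_eq_iff not_False_eq_True)
    then show ?thesis by (auto simp: P_def simp del: of_real_mult)
  qed
  have node: "of_real (pi / h) * of_real (of_int k * h) = (of_real (of_int k * pi) :: complex)" for k :: int
    using h by simp
  have cos_node: "cos (of_real (of_int k * pi)) = (of_real ((-1) powi k) :: complex)" for k :: int
    by (simp only: cos_of_real cos_int_pi)
  have holoF: "F holomorphic_on box (Complex (-a') (-d)) (Complex a' d) - insert (of_real x) P"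
  proof -
    have "\<psi> z \<noteq> 0" if "z \<in> box (Complex (-a') (-d)) (Complex a' d) - insert (of_real x) P" for z
    proof
      assume "\<psi> z = 0"
      then have "s z = 0" using that by (auto simp: \<psi>_def)
      then obtain k where k: "z = of_real (of_int k * h)" using zero by blast
      have "\<bar>of_int k * h\<bar> < a'" using that k by (auto simp: in_box_complex_iff)
      then have "\<bar>of_int k\<bar> < real M + 3/4" using h by (simp add: a'_def abs_mult)
      then have "\<bar>k\<bar> \<le> int M" by linarith
      then have "k \<in> K" by (auto simp: K_def)
      then show False using that k by (auto simp: P_def)
    qed
    moreover have "box (Complex (-a') (-d)) (Complex a' d) - insert (of_real x) P \<subseteq> strip d"
      by (auto simp: in_box_complex_iff strip_def)
    ultimately show ?thesis
      unfolding F_def using \<psi>_def s_def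
      by (auto intro!: holomorphic_intros intro: holomorphic_on_subset[OF holo])
  qed
  have gcont: "isCont g z" if "z \<in> strip d" for z
    using holo that open_strip continuous_on_eq_continuous_at holomorphic_on_imp_continuous_on by blast
  have scont: "isCont s z" for z unfolding s_def by (intro continuous_intros)
  have PR: "insert (of_real x) P \<subseteq> box (Complex (-a) (-c)) (Complex a c)"
  proof -
    have "\<bar>of_int k * h\<bar> < a" if "k \<in> K" for k
    proof -
      have "\<bar>k\<bar> \<le> int M" using that by (auto simp: K_def)
      then have "\<bar>of_int k\<bar> < real M + 1/2" by linarith
      then show ?thesis using h by (simp add: a_def abs_mult)
    qed
    then show ?thesis using c xa by (fastforce simp: P_def in_box_complex_iff abs_less_iff)
  qed
  have lim: "((\<lambda>z. F z * (z - p)) \<longlongrightarrow> r p) (at p)" if p: "p \<in> insert (of_real x) P" for p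
  proof (cases "p = of_real x")
    case True
    have "((\<lambda>z. (g z / s z) / (z - of_real x) * (z - p)) \<longlongrightarrow> (g p / s p) / 1) (at p)"
    proof (rule simple_pole_limit)
      show "isCont (\<lambda>z. g z / s z) p"
        using c sx True by (intro continuous_intros gcont scont) (auto simp: strip_def)
    qed (use True in \<open>auto intro!: derivative_eq_intros\<close>)
    then show ?thesis using True by (simp add: F_def \<psi>_def r_def mult.commute)
  next
    case False
    then obtain k where k: "p = of_real (of_int k * h)" using p by (auto simp: P_def)
    let ?D = "of_real (pi / h) * cos (of_real (pi / h) * p)"
    have "((\<lambda>z. (g z / (z - of_real x)) / s z * (z - p)) \<longlongrightarrow> (g p / (p - of_real x)) / ?D) (at p)"
    proof (rule simple_pole_limit)
      show "isCont (\<lambda>z. g z / (z - of_real x)) p"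
        using c False k by (intro continuous_intros gcont) (auto simp: strip_def)
      show "(s has_field_derivative ?D) (at p)"
        unfolding s_def using h by (auto intro!: derivative_eq_intros)
      show "s p = 0" unfolding s_def k node by (auto simp: sin_eq_0)
      show "?D \<noteq> 0" using h unfolding k node cos_node by simp
    qed
    then show ?thesis using False by (simp add: F_def \<psi>_def r_def)
  qed
  define I where "I = (integral {-a..a} (\<lambda>x. F (Complex x (-c))) - integral {-a..a} (\<lambda>x. F (Complex x c)))
      + \<i> * (integral {-c..c} (\<lambda>y. F (Complex a y)) - integral {-c..c} (\<lambda>y. F (Complex (-a) y)))"
  have "I = 2 * pi * \<i> * (\<Sum>p\<in>insert (of_real x) P. r p)"
    unfolding I_def
    by (rule box_integral_simple_poles[OF a c _ PR holoF lim]) (auto simp: P_def K_def)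
  also have "(\<Sum>p\<in>insert (of_real x) P. r p) = r (of_real x) + (\<Sum>p\<in>P. r p)"
    using xP by (subst sum.insert) (auto simp: P_def K_def)
  also have "(\<Sum>p\<in>P. r p) = (\<Sum>k\<in>K. r (of_real (of_int k * h)))"
    unfolding P_def using h by (subst sum.reindex) (auto simp: inj_on_def)
  finally have I: "I = 2 * pi * \<i> * (r (of_real x) + (\<Sum>k\<in>K. r (of_real (of_int k * h))))" .
  have term_eq: "s (of_real x) * r (of_real (of_int k * h))
      = - (g (of_real (of_int k * h)) * of_real (Sinc_fun k h x))" for k :: int
  proof -
    have ne: "x \<noteq> of_int k * h" by (rule xn)
    have arg: "pi * (x / h - of_int k) = pi * x / h - of_int k * pi"
      by (simp add: algebra_simps)
    have arg0: "pi * (x / h - of_int k) \<noteq> 0" using ne h by (auto simp: field_simps)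
    have sin_sh: "sin (pi * (x / h - of_int k)) = sin (pi * x / h) * (-1) powi k"
      unfolding arg by (simp only: sin_diff sin_int_pi cos_int_pi mult_zero_right diff_zero)
    have S: "Sinc_fun k h x = sin (pi * x / h) * (-1) powi k / (pi * (x / h - of_int k))"
      using arg0 unfolding Sinc_fun_def by (simp only: if_False sin_sh)
    have s: "s (of_real x) = of_real (sin (pi * x / h))"
      unfolding s_def by (simp flip: sin_of_real)
    have sgn: "((-1) powi k :: real) = 1 \<or> ((-1) powi k :: real) = -1"
      by (cases "even k") auto
    have "sin (pi * x / h) / ((of_int k * h - x) * (pi / h * (-1) powi k)) = - Sinc_fun k h x"
      unfolding S using sgn h ne by (auto simp: field_simps)
    then have "of_real (sin (pi * x / h)) / ((of_real (of_int k * h) - of_real x)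
        * (of_real (pi / h) * of_real ((-1) powi k))) = (- of_real (Sinc_fun k h x) :: complex)"
      by (metis of_real_diff of_real_divide of_real_minus of_real_mult)
    moreover have "r (of_real (of_int k * h)) = g (of_real (of_int k * h))
        / (of_real (of_int k * h) - of_real x) / (of_real (pi / h) * of_real ((-1) powi k))"
      using ne[symmetric] unfolding r_def node cos_node by (simp only: of_real_eq_iff if_False)
    then have "s (of_real x) * r (of_real (of_int k * h)) = g (of_real (of_int k * h)) *
        (of_real (sin (pi * x / h)) / ((of_real (of_int k * h) - of_real x)
        * (of_real (pi / h) * of_real ((-1) powi k))))"
      unfolding s by (simp only: divide_divide_eq_left times_divide_eq_right mult.commute)
    ultimately show ?thesis by (simp only: mult_minus_right)
  qed
  have "s (of_real x) * r (of_real x) = g (of_real x)"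
    using sx by (simp add: r_def)
  then have "s (of_real x) * (r (of_real x) + (\<Sum>k\<in>K. r (of_real (of_int k * h))))
      = g (of_real x) - (\<Sum>k\<in>K. g (of_real (of_int k * h)) * of_real (Sinc_fun k h x))"
    by (simp only: distrib_left sum_distrib_left term_eq sum_negf diff_conv_add_uminus)
  then have "s (of_real x) * I = 2 * pi * \<i> *
      (g (of_real x) - (\<Sum>k\<in>K. g (of_real (of_int k * h)) * of_real (Sinc_fun k h x)))"
    unfolding I mult.left_commute[of "s (of_real x)"] by (simp only:)
  then have "norm (s (of_real x)) * norm I = 2 * pi *
      norm (g (of_real x) - (\<Sum>k\<in>K. g (of_real (of_int k * h)) * of_real (Sinc_fun k h x)))"
    unfolding norm_mult[symmetric] by (simp only:) (simp add: norm_mult)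
  moreover have "norm (s (of_real x)) \<le> 1"
    unfolding s_def of_real_mult[symmetric] sin_of_real norm_of_real by simp
  then have "norm (s (of_real x)) * norm I \<le> norm I"
    by (intro mult_left_le_one_le) auto
  ultimately have le: "2 * pi * norm (g (of_real x) - (\<Sum>k\<in>K. g (of_real (of_int k * h)) * of_real (Sinc_fun k h x)))
      \<le> norm I" by simp
  have g_on: "continuous_on (strip d) g"
    using holo by (rule holomorphic_on_imp_continuous_on)
  have sinh_pos: "sinh (pi * c / h) > 0" using c h by simp
  have hor: "c * sinh (pi * c / h) \<le> norm (\<psi> (Complex t y))" if "\<bar>y\<bar> = c" for t y
  proof -
    have "c \<le> norm (Complex t y - of_real x)"
      using abs_Im_le_cmod[of "Complex t y - of_real x"] that by simp
    moreover have "sinh (pi * c / h) \<le> norm (s (Complex t y))"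
      using norm_sin_ge_sinh[of "of_real (pi / h) * Complex t y"] that h
      by (simp add: s_def abs_mult)
    ultimately show ?thesis
      unfolding \<psi>_def norm_mult using c sinh_pos by (intro mult_mono) auto
  qed
  have ver: "a - \<bar>x\<bar> \<le> norm (\<psi> (Complex t y))" if "\<bar>t\<bar> = a" for t y
  proof -
    have "cos (2 * (pi * a / h)) = - 1"
    proof -
      have "2 * (pi * a / h) = real (2 * M + 1) * pi"
        using h by (simp add: a_def field_simps)
      then show ?thesis by (simp only: cos_npi) simp
    qed
    moreover have "cos (2 * (pi * t / h)) = cos (2 * (pi * a / h))"
      using that a by (auto simp: abs_if split: if_splits)
    ultimately have "1 \<le> norm (s (Complex t y))"
      unfolding s_def by (intro norm_sin_ge_1) simp
    moreover have "a - \<bar>x\<bar> \<le> norm (Complex t y - of_real x)"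
      using abs_Re_le_cmod[of "Complex t y - of_real x"] that by simp
    ultimately have "(a - \<bar>x\<bar>) * 1 \<le> norm (\<psi> (Complex t y))"
      unfolding \<psi>_def norm_mult using xa by (intro mult_mono) auto
    then show ?thesis by simp
  qed
  have hor0: "\<psi> (Complex t y) \<noteq> 0" if "\<bar>y\<bar> = c" for t y
    using hor[OF that, of t] mult_pos_pos[OF c(1) sinh_pos] by auto
  have ver0: "\<psi> (Complex t y) \<noteq> 0" if "\<bar>t\<bar> = a" for t y
    using ver[OF that, of y] xa by auto
  have hc: "continuous_on S (\<lambda>x. g (Complex x y))" if "\<bar>y\<bar> < d" for S y
    using that by (intro continuous_on_along_horizontal[OF g_on]) (simp add: Complex_in_strip)
  have vc: "continuous_on {-c..c} (\<lambda>y. g (Complex x y))" for x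
    using c by (intro continuous_on_along_vertical[OF g_on]) (auto simp: Complex_in_strip abs_less_iff)
  have \<psi>h: "continuous_on S (\<lambda>t. \<psi> (Complex t y))" for S y
    unfolding \<psi>_def s_def using h by (auto simp: Complex_eq intro!: continuous_intros)
  have \<psi>v: "continuous_on S (\<lambda>y. \<psi> (Complex t y))" for S t
    unfolding \<psi>_def s_def using h by (auto simp: Complex_eq intro!: continuous_intros)
  have quot: "norm (F z) \<le> norm (g z) / B" if "B \<le> norm (\<psi> z)" "0 < B" for z B
    unfolding F_def norm_divide using that by (intro divide_left_mono mult_pos_pos) auto
  define H where "H = integral {-a..a} (\<lambda>x. norm (g (Complex x c)) + norm (g (Complex x (- c))))"
  define V where "V = integral {-c..c} (\<lambda>y. norm (g (Complex a y)) + norm (g (Complex (- a) y)))"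
  define B where "B = c * sinh (pi * c / h)"
  have B: "B > 0" using c sinh_pos by (simp add: B_def)
  have "norm (integral {-a..a} (\<lambda>x. F (Complex x c)) - integral {-a..a} (\<lambda>x. F (Complex x (-c))))
      \<le> integral {-a..a} (\<lambda>x. norm (g (Complex x c)) / B + norm (g (Complex x (- c))) / B)"
    by (rule norm_integral_diff_le; (rule quot)?)
      (use c B hor hor0 in \<open>auto simp: F_def B_def intro!: continuous_intros hc \<psi>h\<close>)
  also have "\<dots> = H / B"
    unfolding H_def by (simp flip: add_divide_distrib)
  finally have "norm (integral {-a..a} (\<lambda>x. F (Complex x (-c))) - integral {-a..a} (\<lambda>x. F (Complex x c))) \<le> H / B"
    by (simp add: norm_minus_commute)
  moreover
  have "norm (integral {-c..c} (\<lambda>y. F (Complex a y)) - integral {-c..c} (\<lambda>y. F (Complex (-a) y)))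
      \<le> integral {-c..c} (\<lambda>y. norm (g (Complex a y)) / (a - \<bar>x\<bar>) + norm (g (Complex (- a) y)) / (a - \<bar>x\<bar>))"
    by (rule norm_integral_diff_le; (rule quot)?)
      (use c a xa ver ver0 in \<open>auto simp: F_def intro!: continuous_intros vc \<psi>v\<close>)
  then have "norm (integral {-c..c} (\<lambda>y. F (Complex a y)) - integral {-c..c} (\<lambda>y. F (Complex (-a) y))) \<le> V / (a - \<bar>x\<bar>)"
    unfolding V_def by (simp flip: add_divide_distrib)
  ultimately have "norm I \<le> H / B + V / (a - \<bar>x\<bar>)"
    unfolding I_def by (intro order_trans[OF norm_triangle_ineq]) (simp add: norm_mult)
  then have "norm (g (of_real x) - (\<Sum>k\<in>K. g (of_real (of_int k * h)) * of_real (Sinc_fun k h x)))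
      \<le> (H / B + V / (a - \<bar>x\<bar>)) / (2 * pi)"
    using le by (simp add: le_divide_eq mult.commute)
  then show ?thesis by (simp add: K_def H_def V_def B_def)
qed

section \<open>Double exponential decay and the rates of the two errors\<close>

lemma geometric_tail_le:
  fixes t :: real
  assumes "0 < t"
  shows "(\<Sum>j<m. exp (- t) ^ Suc j) \<le> 1 / t"
proof -
  let ?q = "exp (- t)"
  have q: "0 < ?q" "?q < 1" using assms by simp_all
  have "(\<Sum>j<m. ?q ^ Suc j) = ?q * ((1 - ?q ^ m) / (1 - ?q))"
    using q by (simp add: sum_gp_strict flip: sum_distrib_left)
  also have "\<dots> \<le> ?q * (1 / (1 - ?q))"
    using q by (intro mult_left_mono divide_right_mono) auto
  also have "\<dots> = 1 / (exp t - 1)"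
    using assms by (simp add: exp_minus field_simps)
  also have "\<dots> \<le> 1 / t"
  proof (intro divide_left_mono mult_pos_pos)
    show "t \<le> exp t - 1" using exp_ge_add_one_self[of t] by linarith
  qed (use assms in auto)
  finally show ?thesis .
qed

text \<open>
  From \<open>exp t \<ge> 1 + t\<close> one gets \<open>\<beta> exp (\<gamma> k h) \<ge> X + (k - n) X \<gamma> h\<close>, so the terms beyond the
  \<open>n\<close>-th lie below a geometric sequence with ratio \<open>exp (- X \<gamma> h)\<close>.
\<close>

lemma double_exponential_tail_nat:
  fixes \<beta> \<gamma> h :: real and n M :: nat
  assumes "0 < \<beta>" "0 < \<gamma>" "0 < h"
  defines "X \<equiv> \<beta> * exp (\<gamma> * (real n * h))"
  shows "(\<Sum>k\<in>{n<..M}. exp (- \<beta> * exp (\<gamma> * (real k * h)))) \<le> exp (- X) / (X * (\<gamma> * h))"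
proof -
  define t where "t = X * (\<gamma> * h)"
  have X: "X > 0" and t: "t > 0" using assms by (auto simp: X_def t_def)
  have step: "exp (- \<beta> * exp (\<gamma> * (real (n + Suc j) * h))) \<le> exp (- X) * exp (- t) ^ Suc j" for j
  proof -
    have "X * (1 + \<gamma> * h * real (Suc j)) \<le> X * exp (\<gamma> * h * real (Suc j))"
      using X exp_ge_add_one_self by (intro mult_left_mono) auto
    also have "\<dots> = \<beta> * exp (\<gamma> * (real (n + Suc j) * h))"
      unfolding X_def by (simp add: algebra_simps flip: exp_add)
    finally have "- \<beta> * exp (\<gamma> * (real (n + Suc j) * h)) \<le> - X + real (Suc j) * (- t)"
      by (simp add: t_def algebra_simps)
    then show ?thesis
      unfolding exp_of_nat_mult[symmetric] exp_add[symmetric] exp_le_cancel_iff .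
  qed
  have "(\<Sum>k\<in>{n<..M}. exp (- \<beta> * exp (\<gamma> * (real k * h))))
      = (\<Sum>j<M - n. exp (- \<beta> * exp (\<gamma> * (real (n + Suc j) * h))))"
    by (rule sum.reindex_bij_witness[of _ "\<lambda>j. n + Suc j" "\<lambda>k. k - Suc n"]) auto
  also have "\<dots> \<le> (\<Sum>j<M - n. exp (- X) * exp (- t) ^ Suc j)"
    by (intro sum_mono step)
  also have "\<dots> \<le> exp (- X) * (1 / t)"
    unfolding sum_distrib_left[symmetric] by (intro mult_left_mono geometric_tail_le t) auto
  finally show ?thesis by (simp add: t_def)
qed

lemma double_exponential_tail:
  fixes \<beta> \<gamma> h A :: real and n M :: nat and v :: "int \<Rightarrow> real"
  assumes pos: "0 < \<beta>" "0 < \<gamma>" "0 < h" "0 \<le> A"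
    and v: "\<And>k. v k \<le> A * exp (- \<beta> * exp (\<gamma> * \<bar>of_int k * h\<bar>))"
  defines "X \<equiv> \<beta> * exp (\<gamma> * (real n * h))"
  shows "(\<Sum>k\<in>{- int M..int M} - {- int n..int n}. v k) \<le> 2 * A * exp (- X) / (X * (\<gamma> * h))"
proof -
  let ?e = "\<lambda>k. A * exp (- \<beta> * exp (\<gamma> * (real k * h)))"
  have split: "{- int M..int M} - {- int n..int n} = int ` {n<..M} \<union> (\<lambda>k. - int k) ` {n<..M}"
  proof (intro set_eqI iffI)
    fix k assume "k \<in> {- int M..int M} - {- int n..int n}"
    then have "(k = int (nat k) \<and> nat k \<in> {n<..M}) \<or> (k = - int (nat (- k)) \<and> nat (- k) \<in> {n<..M})"
      by auto
    then show "k \<in> int ` {n<..M} \<union> (\<lambda>k. - int k) ` {n<..M}" by blast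
  qed auto
  have "(\<Sum>k\<in>{- int M..int M} - {- int n..int n}. v k)
      = (\<Sum>k\<in>int ` {n<..M}. v k) + (\<Sum>k\<in>(\<lambda>k. - int k) ` {n<..M}. v k)"
    unfolding split by (intro sum.union_disjoint) auto
  also have "\<dots> = (\<Sum>k\<in>{n<..M}. v (int k)) + (\<Sum>k\<in>{n<..M}. v (- int k))"
    by (simp add: sum.reindex inj_on_def)
  also have "\<dots> \<le> (\<Sum>k\<in>{n<..M}. ?e k) + (\<Sum>k\<in>{n<..M}. ?e k)"
  proof (intro add_mono sum_mono)
    fix k
    have "\<bar>real k * h\<bar> = real k * h" using pos by simp
    then show "v (int k) \<le> ?e k" "v (- int k) \<le> ?e k"
      using v[of "int k"] v[of "- int k"] by simp_all
  qed
  also have "\<dots> = 2 * A * (\<Sum>k\<in>{n<..M}. exp (- \<beta> * exp (\<gamma> * (real k * h))))"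
    by (simp flip: sum_distrib_left)
  also have "\<dots> \<le> 2 * A * (exp (- X) / (X * (\<gamma> * h)))"
    unfolding X_def using pos by (intro mult_left_mono double_exponential_tail_nat) auto
  finally show ?thesis by simp
qed

text \<open>
  As \<open>exp t \<ge> t\<^sup>2 / 2\<close> for \<open>t \<ge> 0\<close>, the function is dominated by a Gaussian.
\<close>

lemma integrable_double_exponential:
  fixes \<beta> \<gamma> :: real
  assumes "0 < \<beta>" "0 < \<gamma>"
  shows "integrable lborel (\<lambda>x::real. exp (- \<beta> * exp (\<gamma> * \<bar>x\<bar>)))"
proof -
  define \<sigma> where "\<sigma> = 1 / (\<gamma> * sqrt \<beta>)"
  have \<sigma>: "\<sigma> > 0" using assms by (simp add: \<sigma>_def)
  have "integrable lborel (\<lambda>x. sqrt (2 * pi * \<sigma>\<^sup>2) * normal_density 0 \<sigma> x)"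
    using \<sigma> by (intro integrable_mult_right) auto
  then show ?thesis
  proof (rule Bochner_Integration.integrable_bound)
    show "AE x in lborel. norm (exp (- \<beta> * exp (\<gamma> * \<bar>x\<bar>))) \<le> norm (sqrt (2 * pi * \<sigma>\<^sup>2) * normal_density 0 \<sigma> x)"
    proof (intro AE_I2)
      fix x :: real
      have "(\<gamma> * \<bar>x\<bar>)\<^sup>2 / 2 \<le> exp (\<gamma> * \<bar>x\<bar>)"
        using exp_lower_Taylor_quadratic[of "\<gamma> * \<bar>x\<bar>"] mult_nonneg_nonneg[of \<gamma> "\<bar>x\<bar>"] assms
        by linarith
      then have "\<beta> * ((\<gamma> * \<bar>x\<bar>)\<^sup>2 / 2) \<le> \<beta> * exp (\<gamma> * \<bar>x\<bar>)"
        using assms by (intro mult_left_mono) auto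
      moreover have "x\<^sup>2 / (2 * \<sigma>\<^sup>2) = \<beta> * ((\<gamma> * \<bar>x\<bar>)\<^sup>2 / 2)"
        using assms by (simp add: \<sigma>_def power_mult_distrib power_divide)
      ultimately have "- \<beta> * exp (\<gamma> * \<bar>x\<bar>) \<le> - (x\<^sup>2 / (2 * \<sigma>\<^sup>2))" by simp
      moreover have "sqrt (2 * pi * \<sigma>\<^sup>2) * normal_density 0 \<sigma> x = exp (- (x\<^sup>2 / (2 * \<sigma>\<^sup>2)))"
        using \<sigma> by (simp add: normal_density_def)
      ultimately show "norm (exp (- \<beta> * exp (\<gamma> * \<bar>x\<bar>))) \<le> norm (sqrt (2 * pi * \<sigma>\<^sup>2) * normal_density 0 \<sigma> x)"
        by simp
    qed
  qed simp
qed

text \<open>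
  Write \<open>F t = P t / ln (P t / \<beta>)\<close>.  The logarithm increases with \<open>n\<close>, so among the integers at
  which it is positive it has a least value \<open>l\<^sub>0 > 0\<close>.  Then \<open>F (n + 1/2)\<close> exceeds \<open>F n\<close> by at most
  \<open>P / (2 l\<^sub>0)\<close>.  It also exceeds \<open>P n\<close> by at most a constant: if the logarithm is at least 1, this is
  immediate, and otherwise \<open>P n < \<beta> e\<close>, so everything is bounded.  The lower bound \<open>F n \<ge> \<beta>\<close>
  is \<open>ln s \<le> s\<close>; it keeps denominators such as \<open>1 - exp (- F n)\<close> away from 0.
\<close>

lemma mesh_rates:
  fixes P \<beta> :: real
  assumes "0 < P" "0 < \<beta>"
  obtains K l\<^sub>0 where "0 < K" "0 < l\<^sub>0"
    and "\<And>n::nat. 0 < n \<Longrightarrow> 0 < ln (P * real n / \<beta>) \<Longrightarrow> l\<^sub>0 \<le> ln (P * real n / \<beta>)"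
    and "\<And>n::nat. 0 < n \<Longrightarrow> 0 < ln (P * real n / \<beta>) \<Longrightarrow>
      exp (- (P * real n / ln (P * real n / \<beta>)))
        \<le> K * exp (- (P * (real n + 1/2) / ln (P * (real n + 1/2) / \<beta>)))"
    and "\<And>n::nat. 0 < n \<Longrightarrow> 0 < ln (P * real n / \<beta>) \<Longrightarrow>
      exp (- (P * real n)) \<le> K * exp (- (P * (real n + 1/2) / ln (P * (real n + 1/2) / \<beta>)))"
    and "\<And>n::nat. 0 < n \<Longrightarrow> 0 < ln (P * real n / \<beta>) \<Longrightarrow> \<beta> \<le> P * real n / ln (P * real n / \<beta>)"
proof -
  define l where "l = (\<lambda>t. ln (P * t / \<beta>))"
  have mono: "l s \<le> l t" if "0 < s" "s \<le> t" for s t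
    using that assms unfolding l_def by (subst ln_le_cancel_iff) (auto intro!: divide_right_mono mult_left_mono)
  define n\<^sub>0 where "n\<^sub>0 = (LEAST n::nat. 0 < n \<and> 0 < l (real n))"
  have ex: "\<exists>n::nat. 0 < n \<and> 0 < l (real n)"
  proof -
    obtain n :: nat where n: "\<beta> / P < real n" using reals_Archimedean2 by blast
    then have "1 < P * real n / \<beta>" using assms by (simp add: field_simps)
    moreover have "0 < n" using n assms by (metis divide_pos_pos less_trans of_nat_0_less_iff)
    ultimately show ?thesis unfolding l_def by auto
  qed
  have n\<^sub>0: "0 < n\<^sub>0" "0 < l (real n\<^sub>0)"
    using LeastI_ex[OF ex] by (auto simp: n\<^sub>0_def)
  define l\<^sub>0 where "l\<^sub>0 = l (real n\<^sub>0)"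
  have l\<^sub>0: "0 < l\<^sub>0" using n\<^sub>0 by (simp add: l\<^sub>0_def)
  have low: "l\<^sub>0 \<le> l (real n)" if "0 < n" "0 < l (real n)" for n :: nat
  proof -
    have "n\<^sub>0 \<le> n" unfolding n\<^sub>0_def using that by (intro Least_le) auto
    then show ?thesis unfolding l\<^sub>0_def using n\<^sub>0 by (intro mono) auto
  qed
  define D where "D = P / 2 + (\<beta> * exp 1 + P / 2) / l\<^sub>0"
  have half: "P / 2 / l\<^sub>0 \<le> D"
    using assms l\<^sub>0 unfolding D_def add_divide_distrib by (simp add: add_nonneg_nonneg)
  have mid: "P * (real n + 1/2) / l (real n + 1/2) \<le> P * (real n + 1/2) / l (real n)"
    if "0 < n" "0 < l (real n)" for n :: nat
    using that mono[of "real n" "real n + 1/2"] assms by (intro divide_left_mono mult_pos_pos) auto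
  have F1: "P * (real n + 1/2) / l (real n + 1/2) \<le> P * real n / l (real n) + D"
    if "0 < n" "0 < l (real n)" for n :: nat
  proof -
    have "P * (real n + 1/2) / l (real n) = P * real n / l (real n) + P / 2 / l (real n)"
      by (simp add: distrib_left add_divide_distrib)
    also have "P / 2 / l (real n) \<le> P / 2 / l\<^sub>0"
      using low[OF that] that l\<^sub>0 assms by (intro divide_left_mono mult_pos_pos) auto
    finally show ?thesis using mid[OF that] half by linarith
  qed
  have F2: "P * (real n + 1/2) / l (real n + 1/2) \<le> P * real n + D"
    if "0 < n" "0 < l (real n)" for n :: nat
  proof (cases "1 \<le> l (real n)")
    case True
    then have "P * (real n + 1/2) / l (real n) \<le> P * (real n + 1/2) / 1"
      using assms by (intro divide_left_mono mult_pos_pos) auto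
    moreover have "P / 2 \<le> D" using assms l\<^sub>0 by (simp add: D_def)
    ultimately show ?thesis using mid[OF that] by (simp add: distrib_left)
  next
    case False
    then have "P * real n / \<beta> < exp 1"
      using that assms unfolding l_def
      by (metis divide_pos_pos exp_less_cancel_iff exp_ln mult_pos_pos not_le of_nat_0_less_iff)
    then have "P * real n \<le> \<beta> * exp 1" using assms by (simp add: field_simps)
    then have "P * (real n + 1/2) \<le> \<beta> * exp 1 + P / 2" by (simp add: distrib_left)
    then have "P * (real n + 1/2) / l (real n) \<le> (\<beta> * exp 1 + P / 2) / l\<^sub>0"
      using low[OF that] l\<^sub>0 assms by (intro frac_le) auto
    moreover have "0 \<le> P * real n" using assms by simp
    ultimately show ?thesis using mid[OF that] assms unfolding D_def by linarith
  qed
  show thesis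
  proof (rule that[of "exp D" l\<^sub>0])
    fix n :: nat assume n: "0 < n" "0 < ln (P * real n / \<beta>)"
    then have n': "0 < n" "0 < l (real n)" by (auto simp: l_def)
    show "l\<^sub>0 \<le> ln (P * real n / \<beta>)" using low[OF n'] by (simp add: l_def)
    show "exp (- (P * real n / ln (P * real n / \<beta>)))
        \<le> exp D * exp (- (P * (real n + 1/2) / ln (P * (real n + 1/2) / \<beta>)))"
      using F1[OF n'] unfolding exp_add[symmetric] exp_le_cancel_iff l_def by linarith
    show "exp (- (P * real n)) \<le> exp D * exp (- (P * (real n + 1/2) / ln (P * (real n + 1/2) / \<beta>)))"
      using F2[OF n'] unfolding exp_add[symmetric] exp_le_cancel_iff l_def by linarith
    have "ln (P * real n / \<beta>) \<le> P * real n / \<beta>"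
      using n assms ln_le_minus_one[of "P * real n / \<beta>"] by auto
    then show "\<beta> \<le> P * real n / ln (P * real n / \<beta>)"
      using n(2) assms by (simp add: field_simps)
  qed (use l\<^sub>0 in auto)
qed

section \<open>Exhausting the strip\<close>

text \<open>
  The offset 1/2 keeps the vertical sides half-way between two nodes.  The half-height is the one
  that belongs to the half-width \<open>1 / \<epsilon>\<close> in the boundary integrals that define \<open>L\<close>, so that these
  integrals bound the sides of the same rectangles.
\<close>

definition box_half_width :: "real \<Rightarrow> nat \<Rightarrow> real" where
  "box_half_width h M = (real M + 1/2) * h"

definition box_half_height :: "real \<Rightarrow> real \<Rightarrow> nat \<Rightarrow> real" where
  "box_half_height d h M = d * (1 - 1 / box_half_width h M)"

lemma filterlim_box_half_width:
  assumes "0 < h" shows "filterlim (box_half_width h) at_top sequentially"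
proof -
  have "filterlim (\<lambda>M. h * (1/2 + real M)) at_top sequentially"
    by (intro filterlim_tendsto_pos_mult_at_top[OF tendsto_const assms]
      filterlim_tendsto_add_at_top[OF tendsto_const] filterlim_real_sequentially)
  then show ?thesis by (simp add: box_half_width_def[abs_def] algebra_simps)
qed

lemma tendsto_inverse_box_half_width:
  assumes "0 < h" shows "(\<lambda>M. 1 / box_half_width h M) \<longlonglongrightarrow> 0"
  using tendsto_inverse_0_at_top[OF filterlim_box_half_width[OF assms]] by (simp add: inverse_eq_divide)

lemma tendsto_box_half_height:
  assumes "0 < h" shows "box_half_height d h \<longlonglongrightarrow> d"
proof -
  have "(\<lambda>M. d * (1 - 1 / box_half_width h M)) \<longlonglongrightarrow> d * (1 - 0)"
    by (intro tendsto_intros tendsto_inverse_box_half_width assms)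
  then show ?thesis by (simp add: box_half_height_def[abs_def])
qed

lemma eventually_box_in_strip:
  assumes "0 < d" "0 < h"
  shows "\<forall>\<^sub>F M in sequentially. 1 < box_half_width h M \<and> 0 < box_half_height d h M \<and> box_half_height d h M < d"
proof -
  have "\<forall>\<^sub>F M in sequentially. 1 < box_half_width h M"
    using filterlim_box_half_width[OF assms(2)] by (simp add: filterlim_at_top_dense)
  then show ?thesis
    by eventually_elim (use assms in \<open>auto simp: box_half_height_def field_simps\<close>)
qed

definition horizontal_part :: "(complex \<Rightarrow> complex) \<Rightarrow> real \<Rightarrow> real \<Rightarrow> real" where
  "horizontal_part g a c = integral {-a..a} (\<lambda>x. norm (g (Complex x c)) + norm (g (Complex x (- c))))"

definition vertical_part :: "(complex \<Rightarrow> complex) \<Rightarrow> real \<Rightarrow> real \<Rightarrow> real" where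
  "vertical_part g a c = integral {-c..c} (\<lambda>y. norm (g (Complex a y)) + norm (g (Complex (- a) y)))"

lemma integrable_on_box_edges:
  assumes "continuous_on (strip d) g" "\<bar>c\<bar> < d"
  shows "(\<lambda>x. norm (g (Complex x c)) + norm (g (Complex x (- c)))) integrable_on {-a..a}"
    and "(\<lambda>y. norm (g (Complex a y)) + norm (g (Complex (- a) y))) integrable_on {-c..c}"
  using assms(2)
  by (auto intro!: integrable_continuous_interval continuous_intros
      continuous_on_along_horizontal[OF assms(1)] continuous_on_along_vertical[OF assms(1)]
      simp: Complex_in_strip abs_less_iff)

lemma edge_parts_nonneg:
  assumes "continuous_on (strip d) g" "\<bar>c\<bar> < d"
  shows "0 \<le> horizontal_part g a c" "0 \<le> vertical_part g a c"
  unfolding horizontal_part_def vertical_part_def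
  by (intro integral_nonneg integrable_on_box_edges[OF assms]; simp)+

lemma edge_parts_mono:
  assumes "continuous_on (strip d) g" "continuous_on (strip d) \<omega>" "\<bar>c\<bar> < d"
  shows "(\<And>x y. \<bar>y\<bar> = \<bar>c\<bar> \<Longrightarrow> norm (g (Complex x y)) \<le> B * norm (\<omega> (Complex x y))) \<Longrightarrow>
      horizontal_part g a c \<le> B * horizontal_part \<omega> a c"
    and "(\<And>x y. \<bar>x\<bar> = \<bar>a\<bar> \<Longrightarrow> \<bar>y\<bar> \<le> c \<Longrightarrow> norm (g (Complex x y)) \<le> B * norm (\<omega> (Complex x y))) \<Longrightarrow>
      vertical_part g a c \<le> B * vertical_part \<omega> a c"
  unfolding horizontal_part_def vertical_part_def integral_mult_right[symmetric]
  by (intro integral_le integrable_on_box_edges[OF assms(1,3)] integrable_on_mult_right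
      integrable_on_box_edges[OF assms(2,3)]; force simp: distrib_left intro!: add_mono)+

lemma tendsto_box_boundary:
  assumes "has_N1 \<omega> d L" "0 < h"
  shows "(\<lambda>M. horizontal_part \<omega> (box_half_width h M) (box_half_height d h M)
      + vertical_part \<omega> (box_half_width h M) (box_half_height d h M)) \<longlonglongrightarrow> L"
proof -
  let ?\<epsilon> = "\<lambda>M. 1 / box_half_width h M"
  have "filterlim ?\<epsilon> (at_right 0) sequentially"
    unfolding filterlim_at
    using tendsto_inverse_box_half_width[OF assms(2)] assms(2)
    by (auto simp: box_half_width_def intro!: always_eventually)
  then have "(\<lambda>M. box_boundary_integral \<omega> d (?\<epsilon> M)) \<longlonglongrightarrow> L"
    using assms(1) unfolding has_N1_def by (rule filterlim_compose[rotated])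
  then show ?thesis
    by (simp add: box_boundary_integral_def horizontal_part_def vertical_part_def box_half_height_def Let_def)
qed

lemma has_N1_nonneg:
  assumes "has_N1 \<omega> d L" "continuous_on (strip d) \<omega>" "0 < d"
  shows "0 \<le> L"
proof (rule tendsto_lowerbound[OF tendsto_box_boundary[OF assms(1), of 1]])
  show "\<forall>\<^sub>F M in sequentially. 0 \<le> horizontal_part \<omega> (box_half_width 1 M) (box_half_height d 1 M)
      + vertical_part \<omega> (box_half_width 1 M) (box_half_height d 1 M)"
    using eventually_box_in_strip[OF assms(3), of 1]
    by (auto elim!: eventually_mono intro!: add_nonneg_nonneg edge_parts_nonneg[OF assms(2)])
qed auto

lemma Sinc_fun_le_1: "\<bar>Sinc_fun k h x\<bar> \<le> 1"
  using abs_sin_x_le_abs_x[of "pi * (x / h - of_int k)"]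
  by (auto simp: Sinc_fun_def divide_le_eq abs_divide)

text \<open>
  \<open>L\<close> governs the discretisation error, and \<open>\<alpha>\<close>, \<open>\<beta>\<close>, \<open>\<gamma>\<close> govern the truncation error.
\<close>

locale double_exponential_weight =
  fixes d :: real and \<omega> :: "complex \<Rightarrow> complex" and L \<alpha> \<beta> \<gamma> :: real
  assumes pos: "0 < d" "0 < \<alpha>" "0 < \<beta>" "0 < \<gamma>"
    and holo_\<omega>: "\<omega> holomorphic_on strip d"
    and N1: "has_N1 \<omega> d L"
    and decay: "\<And>x::real. norm (\<omega> (of_real x)) \<le> \<alpha> * exp (- \<beta> * exp (\<gamma> * \<bar>x\<bar>))"
begin

text \<open>
  The value of the bound in \<open>double_exponential_tail\<close>, twice the amplitude included.
\<close>

definition node_tail :: "nat \<Rightarrow> real \<Rightarrow> real" where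
  "node_tail n h = 2 * \<alpha> * exp (- (\<beta> * exp (\<gamma> * (real n * h)))) / (\<beta> * exp (\<gamma> * (real n * h)) * (\<gamma> * h))"

lemma cont_\<omega>: "continuous_on (strip d) \<omega>"
  using holo_\<omega> by (rule holomorphic_on_imp_continuous_on)

lemma node_tail_bound:
  assumes "0 < h" "\<And>k. v k \<le> norm (\<omega> (of_real (of_int k * h)))"
  shows "(\<Sum>k\<in>{- int M..int M} - {- int n..int n}. v k) \<le> node_tail n h"
  unfolding node_tail_def
  using pos assms(1) order_trans[OF assms(2) decay]
  by (intro double_exponential_tail) auto

lemma integrable_of_bound:
  assumes "g holomorphic_on strip d" "\<And>z. z \<in> strip d \<Longrightarrow> norm (g z) \<le> norm (\<omega> z)"
  shows "integrable lborel (\<lambda>x. g (of_real x))"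
proof (rule Bochner_Integration.integrable_bound)
  show "integrable lborel (\<lambda>x::real. \<alpha> * exp (- \<beta> * exp (\<gamma> * \<bar>x\<bar>)))"
    using pos by (intro integrable_mult_right integrable_double_exponential)
  show "(\<lambda>x. g (of_real x)) \<in> borel_measurable lborel"
    using continuous_on_along_reals[OF holomorphic_on_imp_continuous_on[OF assms(1)] pos(1), of UNIV]
    by (simp add: borel_measurable_continuous_onI)
  have "norm (g (of_real x)) \<le> \<alpha> * exp (- \<beta> * exp (\<gamma> * \<bar>x\<bar>))" for x
    using pos by (intro order_trans[OF assms(2) decay]) (auto simp: strip_def)
  then show "AE x in lborel. norm (g (of_real x)) \<le> norm (\<alpha> * exp (- \<beta> * exp (\<gamma> * \<bar>x\<bar>)))"
    using pos by (intro AE_I2) auto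
qed

text \<open>
  \<open>G M\<close> is the regularised function on the \<open>M\<close>-th rectangle.  Its modulus is
  \<open>\<bar>g\<bar> exp ((y\<^sup>2 - x\<^sup>2) / A)\<close>, hence at most \<open>\<bar>g\<bar>\<close> on the real axis, so that the tail bound and
  dominated convergence apply to it with the majorants of \<open>g\<close> itself.
\<close>

lemma trapezoidal_error_le:
  assumes holo: "g holomorphic_on strip d" and bound: "\<And>z. z \<in> strip d \<Longrightarrow> norm (g z) \<le> norm (\<omega> z)"
    and h: "0 < h"
  shows "norm ((LBINT x. g (of_real x)) - of_real h * (\<Sum>k\<in>{- int n..int n}. g (of_real (of_int k * h))))
      \<le> L / (exp (2 * pi * d / h) - 1) + h * node_tail n h"
proof -
  define A where "A = box_half_width h"
  define c where "c = box_half_height d h"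
  define G where "G = (\<lambda>M z. g z * exp (- (z\<^sup>2 / of_real (A M))))"
  define S where "S = (\<lambda>M (n::nat). of_real h * (\<Sum>k\<in>{- int n..int n}. G M (of_real (of_int k * h))))"
  define J where "J = (\<lambda>M. integral {- A M..A M} (\<lambda>x. G M (of_real x)))"
  define W where "W = (\<lambda>M. horizontal_part \<omega> (A M) (c M) + vertical_part \<omega> (A M) (c M))"
  define E where "E = (\<lambda>M. exp (d\<^sup>2 * (1 / A M)))"
  have A0: "A M > 0" for M using h by (simp add: A_def box_half_width_def)
  have lim_A: "filterlim A at_top sequentially" unfolding A_def by (rule filterlim_box_half_width[OF h])
  have lim_inv: "(\<lambda>M. 1 / A M) \<longlonglongrightarrow> 0" unfolding A_def by (rule tendsto_inverse_box_half_width[OF h])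
  have lim_c: "c \<longlonglongrightarrow> d" unfolding c_def by (rule tendsto_box_half_height[OF h])
  have lim_W: "W \<longlonglongrightarrow> L" unfolding W_def A_def c_def by (rule tendsto_box_boundary[OF N1 h])
  have lim_E: "E \<longlonglongrightarrow> 1"
    unfolding E_def using tendsto_exp[OF tendsto_mult[OF tendsto_const lim_inv], of "d\<^sup>2"] by simp
  have holo_G: "G M holomorphic_on strip d" for M
    unfolding G_def using holo A0[of M] by (auto intro!: holomorphic_intros)
  have norm_G: "norm (G M (Complex x y)) = norm (g (Complex x y)) * exp (y\<^sup>2 / A M - x\<^sup>2 / A M)" for M x y
    unfolding G_def norm_mult norm_exp_eq_Re
    by (simp add: Re_divide_of_real Re_power2 diff_divide_distrib)
  have norm_G_real: "norm (G M (of_real x)) \<le> norm (g (of_real x))" for M x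
    using norm_G[of M x 0] A0[of M] by (simp add: complex_of_real_def mult_left_le)
  have cont_G: "continuous_on (strip d) (G M)" for M
    using holo_G by (rule holomorphic_on_imp_continuous_on)
  have box: "norm (J M - S M M)
      \<le> E M * W M / (exp (2 * pi * c M / h) - 1) + 2 * (E M * exp (- A M)) * W M"
    if c: "0 < c M" "c M < d" for M
  proof -
    have cd: "\<bar>c M\<bar> < d" using c by simp
    note nonneg = edge_parts_nonneg[OF cont_\<omega> cd, of "A M"]
    have "norm (G M (Complex x y)) \<le> E M * norm (\<omega> (Complex x y))" if "\<bar>y\<bar> = \<bar>c M\<bar>" for x y
    proof -
      have "y\<^sup>2 \<le> d\<^sup>2" using that c by (intro abs_le_square_iff[THEN iffD1]) auto
      then have "y\<^sup>2 / A M - x\<^sup>2 / A M \<le> d\<^sup>2 * (1 / A M)"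
        using A0[of M] by (simp add: field_simps add_increasing2)
      then have "exp (y\<^sup>2 / A M - x\<^sup>2 / A M) \<le> E M" by (simp add: E_def)
      moreover have "norm (g (Complex x y)) \<le> norm (\<omega> (Complex x y))"
        using that cd by (intro bound) (simp add: Complex_in_strip)
      ultimately show ?thesis
        unfolding norm_G by (subst mult.commute) (intro mult_mono; simp add: E_def)
    qed
    then have "horizontal_part (G M) (A M) (c M) \<le> E M * horizontal_part \<omega> (A M) (c M)"
      by (rule edge_parts_mono(1)[OF cont_G cont_\<omega> cd])
    also have "\<dots> \<le> E M * W M"
      unfolding W_def using nonneg by (intro mult_left_mono) (auto simp: E_def)
    finally have hor: "horizontal_part (G M) (A M) (c M) \<le> E M * W M" .
    have "norm (G M (Complex x y)) \<le> (E M * exp (- A M)) * norm (\<omega> (Complex x y))"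
      if "\<bar>x\<bar> = \<bar>A M\<bar>" "\<bar>y\<bar> \<le> c M" for x y
    proof -
      have "y\<^sup>2 \<le> d\<^sup>2" using that c by (intro abs_le_square_iff[THEN iffD1]) auto
      moreover have "x\<^sup>2 = (A M)\<^sup>2" using that by (metis power2_abs)
      ultimately have "y\<^sup>2 / A M - x\<^sup>2 / A M \<le> d\<^sup>2 * (1 / A M) + - A M"
        using A0[of M] by (simp add: field_simps power2_eq_square)
      then have "exp (y\<^sup>2 / A M - x\<^sup>2 / A M) \<le> E M * exp (- A M)"
        unfolding E_def exp_add[symmetric] exp_le_cancel_iff .
      moreover have "norm (g (Complex x y)) \<le> norm (\<omega> (Complex x y))"
        using that c by (intro bound) (simp add: Complex_in_strip)
      ultimately show ?thesis
        unfolding norm_G by (subst mult.commute) (intro mult_mono; simp add: E_def)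
    qed
    then have "vertical_part (G M) (A M) (c M) \<le> (E M * exp (- A M)) * vertical_part \<omega> (A M) (c M)"
      by (rule edge_parts_mono(2)[OF cont_G cont_\<omega> cd])
    also have "\<dots> \<le> (E M * exp (- A M)) * W M"
      unfolding W_def using nonneg by (intro mult_left_mono) (auto simp: E_def)
    finally have ver: "vertical_part (G M) (A M) (c M) \<le> E M * exp (- A M) * W M" .
    have "norm (J M - S M M) \<le> horizontal_part (G M) (A M) (c M) / (exp (2 * pi * c M / h) - 1)
        + 2 * vertical_part (G M) (A M) (c M)"
      unfolding J_def S_def horizontal_part_def vertical_part_def A_def box_half_width_def
      by (rule trapezoidal_error_box[OF holo_G c h])
    also have "\<dots> \<le> E M * W M / (exp (2 * pi * c M / h) - 1) + 2 * (E M * exp (- A M) * W M)"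
      using hor ver c h by (intro add_mono divide_right_mono mult_left_mono) auto
    finally show ?thesis by simp
  qed
  have tail: "norm (S M M - S M n) \<le> h * node_tail n h" if "n \<le> M" for M
  proof -
    have "S M M - S M n = of_real h * (\<Sum>k\<in>{- int M..int M} - {- int n..int n}. G M (of_real (of_int k * h)))"
      using that unfolding S_def by (subst sum_diff) (auto simp: right_diff_distrib)
    also have "norm \<dots> \<le> h * (\<Sum>k\<in>{- int M..int M} - {- int n..int n}. norm (G M (of_real (of_int k * h))))"
      unfolding norm_mult using h by (auto intro!: mult_mono norm_sum)
    also have "\<dots> \<le> h * node_tail n h"
      using h pos
      by (intro mult_left_mono node_tail_bound order_trans[OF norm_G_real bound]) (auto simp: strip_def)
    finally show ?thesis .
  qed
  have int_g: "integrable lborel (\<lambda>x. g (of_real x))" by (rule integrable_of_bound[OF holo bound])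
  have cont_G_real: "continuous_on X (\<lambda>x. G M (of_real x))" for M X
    by (rule continuous_on_along_reals[OF cont_G pos(1)])
  have G_tendsto: "(\<lambda>M. G M (of_real x)) \<longlonglongrightarrow> g (of_real x)" for x
  proof -
    have "(\<lambda>M. g (of_real x) * exp (- ((of_real x)\<^sup>2 * of_real (1 / A M)))) \<longlonglongrightarrow>
        g (of_real x) * exp (- ((of_real x)\<^sup>2 * of_real 0))"
      by (intro tendsto_intros lim_inv)
    then show ?thesis by (simp add: G_def)
  qed
  have J_eq: "J M = (LBINT x. indicator {- A M..A M} x *\<^sub>R G M (of_real x))" for M
  proof -
    have "set_integrable lborel {- A M..A M} (\<lambda>x. G M (of_real x))"
      by (rule borel_integrable_atLeastAtMost') (rule cont_G_real)
    then show ?thesis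
      unfolding J_def by (subst set_borel_integral_eq_integral(2)[symmetric]) (auto simp: set_lebesgue_integral_def)
  qed
  have lim_J: "J \<longlonglongrightarrow> (LBINT x. g (of_real x))"
    unfolding J_eq[abs_def]
  proof (rule integral_dominated_convergence)
    show "integrable lborel (\<lambda>x. norm (g (of_real x)))" using int_g by simp
    show "(\<lambda>x. g (of_real x)) \<in> borel_measurable lborel" using int_g by simp
    show "(\<lambda>x. indicator {- A M..A M} x *\<^sub>R G M (of_real x)) \<in> borel_measurable lborel" for M
      using borel_measurable_continuous_onI[OF cont_G_real[of UNIV M]]
      by (intro borel_measurable_scaleR) auto
    show "AE x in lborel. norm (indicator {- A M..A M} x *\<^sub>R G M (of_real x)) \<le> norm (g (of_real x))" for M
      using norm_G_real by (intro AE_I2) (auto simp: indicator_def)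
    show "AE x in lborel. (\<lambda>M. indicator {- A M..A M} x *\<^sub>R G M (of_real x)) \<longlonglongrightarrow> g (of_real x)"
    proof (intro AE_I2)
      fix x :: real
      have "\<forall>\<^sub>F M in sequentially. \<bar>x\<bar> < A M" using lim_A by (simp add: filterlim_at_top_dense)
      then have "\<forall>\<^sub>F M in sequentially. G M (of_real x) = indicator {- A M..A M} x *\<^sub>R G M (of_real x)"
        by eventually_elim (auto simp: indicator_def)
      then show "(\<lambda>M. indicator {- A M..A M} x *\<^sub>R G M (of_real x)) \<longlonglongrightarrow> g (of_real x)"
        by (rule Lim_transform_eventually[OF G_tendsto])
    qed
  qed
  have lim_S: "(\<lambda>M. S M n) \<longlonglongrightarrow> of_real h * (\<Sum>k\<in>{- int n..int n}. g (of_real (of_int k * h)))"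
    unfolding S_def by (intro tendsto_intros G_tendsto)
  have lim_exp: "(\<lambda>M. exp (- A M)) \<longlonglongrightarrow> 0"
    using lim_A by (intro filterlim_compose[OF exp_at_bot]) (simp add: filterlim_uminus_at_top)
  have "exp (2 * pi * d / h) - 1 \<noteq> 0" using pos h by simp
  then have lim_rhs: "(\<lambda>M. E M * W M / (exp (2 * pi * c M / h) - 1) + 2 * (E M * exp (- A M)) * W M + h * node_tail n h)
      \<longlonglongrightarrow> 1 * L / (exp (2 * pi * d / h) - 1) + 2 * (1 * 0) * L + h * node_tail n h"
    by (intro tendsto_intros lim_E lim_W lim_c lim_exp) (use h in auto)
  \<comment> \<open>The tail bound allows the sum over \<open>\<bar>k\<bar> \<le> M\<close> to be cut at \<open>n\<close> before \<open>M\<close> tends to infinity.\<close>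
  have "\<forall>\<^sub>F M in sequentially. norm (J M - S M n)
      \<le> E M * W M / (exp (2 * pi * c M / h) - 1) + 2 * (E M * exp (- A M)) * W M + h * node_tail n h"
    using eventually_box_in_strip[OF pos(1) h] eventually_ge_at_top[of n]
  proof eventually_elim
    case (elim M)
    then have "0 < c M" "c M < d" by (auto simp: c_def)
    moreover have "norm (J M - S M n) \<le> norm (J M - S M M) + norm (S M M - S M n)"
      using norm_triangle_ineq[of "J M - S M M" "S M M - S M n"] by simp
    ultimately show ?case using box[of M] tail[of M] elim by linarith
  qed
  from tendsto_le[OF _ lim_rhs tendsto_norm[OF tendsto_diff[OF lim_J lim_S]] this]
  show ?thesis by simp
qed

text \<open>
  At a node the approximation either reproduces \<open>g x\<close> or, beyond the \<open>n\<close>-th node, vanishes, and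
  then \<open>\<bar>g x\<bar>\<close> is a single term of the tail.  At all other points the rectangle estimate applies.
\<close>

lemma sinc_error_le:
  assumes holo: "g holomorphic_on strip d" and bound: "\<And>z. z \<in> strip d \<Longrightarrow> norm (g z) \<le> norm (\<omega> z)"
    and h: "0 < h"
  shows "norm (g (of_real x) - (\<Sum>k\<in>{- int n..int n}. g (of_real (of_int k * h)) * of_real (Sinc_fun k h x)))
      \<le> L / (2 * pi * d * sinh (pi * d / h)) + node_tail n h"
proof -
  define S where "S = (\<lambda>M::nat. \<Sum>k\<in>{- int M..int M}. g (of_real (of_int k * h)) * of_real (Sinc_fun k h x))"
  have tail: "(\<Sum>k\<in>{- int M..int M} - {- int n..int n}. norm (g (of_real (of_int k * h)))) \<le> node_tail n h" for M
    using h pos by (intro node_tail_bound bound) (auto simp: strip_def)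
  have L0: "0 \<le> L" using has_N1_nonneg[OF N1 cont_\<omega> pos(1)] .
  have sinh0: "0 < sinh (pi * d / h)" using pos h by simp
  have disc0: "0 \<le> L / (2 * pi * d * sinh (pi * d / h))"
    using L0 sinh0 pos by (intro divide_nonneg_nonneg mult_nonneg_nonneg) auto
  show ?thesis
  proof (cases "\<exists>j. x = of_int j * h")
    case True
    then obtain j :: int where j: "x = of_int j * h" by blast
    have "(\<Sum>k\<in>{- int n..int n}. g (of_real (of_int k * h)) * of_real (Sinc_fun k h x))
        = (\<Sum>k\<in>{- int n..int n}. if k = j then g (of_real (of_int j * h)) else 0)"
      unfolding j using h by (intro sum.cong) (auto simp: Sinc_fun_node)
    also have "\<dots> = (if j \<in> {- int n..int n} then g (of_real x) else 0)"
      unfolding j by (simp add: sum.delta)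
    finally have eq: "(\<Sum>k\<in>{- int n..int n}. g (of_real (of_int k * h)) * of_real (Sinc_fun k h x))
        = (if j \<in> {- int n..int n} then g (of_real x) else 0)" .
    have "norm (g (of_real x) - (if j \<in> {- int n..int n} then g (of_real x) else 0)) \<le> node_tail n h"
    proof (cases "j \<in> {- int n..int n}")
      case True
      then show ?thesis using tail[of n] by simp
    next
      case False
      then have "norm (g (of_real (of_int j * h)))
          \<le> (\<Sum>k\<in>{- int (nat \<bar>j\<bar>)..int (nat \<bar>j\<bar>)} - {- int n..int n}. norm (g (of_real (of_int k * h))))"
        by (intro member_le_sum) auto
      then show ?thesis using tail[of "nat \<bar>j\<bar>"] False unfolding j by (auto split: if_splits)
    qed
    then show ?thesis unfolding eq using disc0 by linarith
  next
    case False
    define A where "A = box_half_width h"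
    define c where "c = box_half_height d h"
    define W where "W = (\<lambda>M. horizontal_part \<omega> (A M) (c M) + vertical_part \<omega> (A M) (c M))"
    have lim_A: "filterlim A at_top sequentially" unfolding A_def by (rule filterlim_box_half_width[OF h])
    have lim_c: "c \<longlonglongrightarrow> d" unfolding c_def by (rule tendsto_box_half_height[OF h])
    have lim_W: "W \<longlonglongrightarrow> L" unfolding W_def A_def c_def by (rule tendsto_box_boundary[OF N1 h])
    have cont_g: "continuous_on (strip d) g" using holo by (rule holomorphic_on_imp_continuous_on)
    have box: "norm (g (of_real x) - S M) \<le> (W M / (c M * sinh (pi * c M / h)) + W M * inverse (A M - \<bar>x\<bar>)) / (2 * pi)"
      if c: "0 < c M" "c M < d" and x: "\<bar>x\<bar> < A M" for M
    proof -
      have cd: "\<bar>c M\<bar> < d" using c by simp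
      note nonneg = edge_parts_nonneg[OF cont_\<omega> cd, of "A M"]
      have "horizontal_part g (A M) (c M) \<le> 1 * horizontal_part \<omega> (A M) (c M)"
        by (rule edge_parts_mono(1)[OF cont_g cont_\<omega> cd])
          (use bound cd in \<open>auto simp: Complex_in_strip\<close>)
      then have hor: "horizontal_part g (A M) (c M) \<le> W M" using nonneg by (simp add: W_def)
      have "vertical_part g (A M) (c M) \<le> 1 * vertical_part \<omega> (A M) (c M)"
        by (rule edge_parts_mono(2)[OF cont_g cont_\<omega> cd])
          (use bound cd in \<open>auto simp: Complex_in_strip\<close>)
      then have ver: "vertical_part g (A M) (c M) \<le> W M" using nonneg by (simp add: W_def)
      have "norm (g (of_real x) - S M) \<le> (horizontal_part g (A M) (c M) / (c M * sinh (pi * c M / h))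
          + vertical_part g (A M) (c M) / (A M - \<bar>x\<bar>)) / (2 * pi)"
        using x False unfolding S_def horizontal_part_def vertical_part_def A_def box_half_width_def
        by (intro sinc_error_box[OF holo c h]) auto
      also have "\<dots> \<le> (W M / (c M * sinh (pi * c M / h)) + W M / (A M - \<bar>x\<bar>)) / (2 * pi)"
        using hor ver c h x by (intro add_mono divide_right_mono) auto
      finally show ?thesis by (simp only: divide_inverse[of "W M" "A M - \<bar>x\<bar>"])
    qed
    have tail_S: "norm (S M - S n) \<le> node_tail n h" if "n \<le> M" for M
    proof -
      have "S M - S n = (\<Sum>k\<in>{- int M..int M} - {- int n..int n}. g (of_real (of_int k * h)) * of_real (Sinc_fun k h x))"
        using that unfolding S_def by (subst sum_diff) auto
      also have "norm \<dots> \<le> (\<Sum>k\<in>{- int M..int M} - {- int n..int n}. norm (g (of_real (of_int k * h))))"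
        using Sinc_fun_le_1 by (intro sum_norm_le) (auto simp: norm_mult intro!: mult_left_le)
      finally show ?thesis using tail[of M] by linarith
    qed
    have lim_gap: "(\<lambda>M. inverse (A M - \<bar>x\<bar>)) \<longlonglongrightarrow> 0"
      by (intro tendsto_inverse_0_at_top filterlim_tendsto_add_at_top[OF tendsto_const lim_A, of "- \<bar>x\<bar>", simplified])
    have nz: "d * sinh (pi * d / h) \<noteq> 0" using pos h by simp
    have lim_rhs: "(\<lambda>M. (W M / (c M * sinh (pi * c M / h)) + W M * inverse (A M - \<bar>x\<bar>)) / (2 * pi) + node_tail n h)
        \<longlonglongrightarrow> (L / (d * sinh (pi * d / h)) + L * 0) / (2 * pi) + node_tail n h"
      by (intro tendsto_intros lim_W lim_c lim_gap) (use h nz in auto)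
    have "\<forall>\<^sub>F M in sequentially. \<bar>x\<bar> < A M" using lim_A by (simp add: filterlim_at_top_dense)
    then have ev: "\<forall>\<^sub>F M in sequentially. norm (g (of_real x) - S n)
        \<le> (W M / (c M * sinh (pi * c M / h)) + W M * inverse (A M - \<bar>x\<bar>)) / (2 * pi) + node_tail n h"
      using eventually_box_in_strip[OF pos(1) h] eventually_ge_at_top[of n]
    proof eventually_elim
      case (elim M)
      then have "0 < c M" "c M < d" by (auto simp: c_def)
      moreover have "norm (g (of_real x) - S n) \<le> norm (g (of_real x) - S M) + norm (S M - S n)"
        using norm_triangle_ineq[of "g (of_real x) - S M" "S M - S n"] by simp
      ultimately show ?case using box[of M] tail_S[of M] elim by linarith
    qed
    have "norm (g (of_real x) - S n) \<le> (L / (d * sinh (pi * d / h)) + L * 0) / (2 * pi) + node_tail n h"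
      by (rule tendsto_lowerbound[OF lim_rhs ev]) auto
    also have "(L / (d * sinh (pi * d / h)) + L * 0) / (2 * pi) = L / (2 * pi * d * sinh (pi * d / h))"
      by (simp add: mult_ac)
    finally show ?thesis by (simp add: S_def)
  qed
qed

end

section \<open>Error norms at the chosen mesh size\<close>

lemma unit_ball_bound:
  assumes "g \<in> H_unit_ball d \<omega>" "z \<in> strip d" "\<omega> z \<noteq> 0"
  shows "norm (g z) \<le> norm (\<omega> z)"
proof -
  have "norm (g z / \<omega> z) \<le> H_norm d \<omega> g"
    unfolding H_norm_def
    using assms(1,2) by (intro cSUP_upper) (auto simp: H_unit_ball_def H_infty_def)
  also have "\<dots> \<le> 1" using assms(1) by (simp add: H_unit_ball_def)
  finally show ?thesis using assms(3) by (simp add: norm_divide divide_le_eq)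
qed

lemma unit_ball_holomorphic:
  assumes "g \<in> H_unit_ball d \<omega>"
  shows "g holomorphic_on strip d"
  using assms by (simp add: H_unit_ball_def H_infty_def analytic_on_strip)

context double_exponential_weight
begin

text \<open>
  The mesh is chosen so that \<open>\<beta> exp (\<gamma> n h) = P n\<close>.
\<close>

lemma node_tail_at_mesh:
  assumes "0 < P" "0 < n" "h = l / (\<gamma> * real n)" "l = ln (P * real n / \<beta>)" "0 < l"
  shows "node_tail n h = 2 * \<alpha> * exp (- (P * real n)) / (P * l)"
proof -
  have "\<gamma> * (real n * h) = l" "\<gamma> * h = l / real n" using assms pos by auto
  moreover have "\<beta> * exp l = P * real n" using assms pos by simp
  ultimately show ?thesis using assms(2) unfolding node_tail_def by simp
qed

text \<open>
  With \<open>d \<gamma> = \<pi> / 2\<close> the discretisation exponent \<open>2 \<pi> d / h\<close> is \<open>\<pi>\<^sup>2 n / ln (\<pi>\<^sup>2 n / \<beta>)\<close>.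
  The factor \<open>h\<close> in front of the tail cancels its logarithmic denominator.
\<close>

lemma trapezoidal_error_rate:
  assumes nz: "\<And>z. z \<in> strip d \<Longrightarrow> \<omega> z \<noteq> 0" and dg: "d * \<gamma> = pi / 2"
  shows "\<exists>C>0. \<forall>n::nat. \<forall>h. 0 < n \<and> h = ln (pi\<^sup>2 * real n / \<beta>) / (\<gamma> * real n) \<and> 0 < h \<longrightarrow>
    trapezoidal_error n h d \<omega>
      \<le> ennreal (C * exp (- (pi\<^sup>2 * (real n + 1/2) / ln (pi\<^sup>2 * (real n + 1/2) / \<beta>))))"
proof -
  define P where "P = pi\<^sup>2"
  have P: "0 < P" by (simp add: P_def)
  obtain K l\<^sub>0 where K: "0 < K" and "0 < l\<^sub>0"
    and "\<And>n::nat. 0 < n \<Longrightarrow> 0 < ln (P * real n / \<beta>) \<Longrightarrow> l\<^sub>0 \<le> ln (P * real n / \<beta>)"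
    and disc: "\<And>n::nat. 0 < n \<Longrightarrow> 0 < ln (P * real n / \<beta>) \<Longrightarrow> exp (- (P * real n / ln (P * real n / \<beta>)))
        \<le> K * exp (- (P * (real n + 1/2) / ln (P * (real n + 1/2) / \<beta>)))"
    and trunc: "\<And>n::nat. 0 < n \<Longrightarrow> 0 < ln (P * real n / \<beta>) \<Longrightarrow>
      exp (- (P * real n)) \<le> K * exp (- (P * (real n + 1/2) / ln (P * (real n + 1/2) / \<beta>)))"
    and low: "\<And>n::nat. 0 < n \<Longrightarrow> 0 < ln (P * real n / \<beta>) \<Longrightarrow> \<beta> \<le> P * real n / ln (P * real n / \<beta>)"
    by (rule mesh_rates[OF P pos(3)]) (rule that)
  have L0: "0 \<le> L" using has_N1_nonneg[OF N1 cont_\<omega> pos(1)] .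
  have q: "0 < 1 - exp (- \<beta>)" using pos by simp
  define C where "C = L * K / (1 - exp (- \<beta>)) + 2 * \<alpha> * K / (P * \<gamma>)"
  have C: "0 < C" unfolding C_def using L0 K q pos P by (intro add_nonneg_pos) auto
  show ?thesis
  proof (intro exI[of _ C] conjI allI impI C, elim conjE)
    fix n :: nat and h assume n: "0 < n" and h: "h = ln (pi\<^sup>2 * real n / \<beta>) / (\<gamma> * real n)" "0 < h"
    define l where "l = ln (P * real n / \<beta>)"
    define R where "R = exp (- (P * (real n + 1/2) / ln (P * (real n + 1/2) / \<beta>)))"
    have h_eq: "h = l / (\<gamma> * real n)" using h by (simp add: l_def P_def)
    have "l = h * (\<gamma> * real n)" using h_eq n pos by simp
    then have l: "0 < l" using h(2) n pos by simp
    have \<gamma>h: "\<gamma> * h = l / real n" using h_eq pos by simp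
    have "2 * pi * d / h = 2 * pi * (d * \<gamma>) / (\<gamma> * h)" using pos by simp
    also have "\<dots> = P * real n / l" unfolding dg \<gamma>h by (simp add: P_def power2_eq_square)
    finally have F: "2 * pi * d / h = P * real n / l" .
    define F where "F = P * real n / l"
    have "\<beta> \<le> F" using low[OF n] l by (simp add: F_def l_def)
    then have "1 - exp (- \<beta>) \<le> 1 - exp (- F)" by simp
    have "L / (exp F - 1) = L * exp (- F) / (1 - exp (- F))"
      by (simp add: exp_minus divide_simps)
    also have "\<dots> \<le> L * exp (- F) / (1 - exp (- \<beta>))"
      using q L0 \<open>1 - exp (- \<beta>) \<le> 1 - exp (- F)\<close> by (intro divide_left_mono mult_pos_pos) auto
    also have "\<dots> \<le> L * (K * R) / (1 - exp (- \<beta>))"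
      using disc[OF n] l L0 q unfolding F_def R_def l_def by (intro divide_right_mono mult_left_mono) auto
    finally have part1: "L / (exp (2 * pi * d / h) - 1) \<le> L * K / (1 - exp (- \<beta>)) * R"
      unfolding F F_def by simp
    have "h * node_tail n h = 2 * \<alpha> * exp (- (P * real n)) / (P * \<gamma> * real n)"
      unfolding node_tail_at_mesh[OF P n h_eq l_def l] using l n h_eq by (simp add: mult_ac)
    also have "\<dots> \<le> 2 * \<alpha> * exp (- (P * real n)) / (P * \<gamma> * 1)"
      using n P pos by (intro divide_left_mono mult_left_mono mult_pos_pos) auto
    also have "\<dots> \<le> 2 * \<alpha> * (K * R) / (P * \<gamma> * 1)"
      using trunc[OF n] l P pos unfolding R_def l_def by (intro divide_right_mono mult_left_mono) auto
    finally have part2: "h * node_tail n h \<le> 2 * \<alpha> * K / (P * \<gamma>) * R" by simp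
    have total: "L / (exp (2 * pi * d / h) - 1) + h * node_tail n h \<le> C * R"
      using part1 part2 unfolding C_def distrib_right by linarith
    show "trapezoidal_error n h d \<omega>
      \<le> ennreal (C * exp (- (pi\<^sup>2 * (real n + 1/2) / ln (pi\<^sup>2 * (real n + 1/2) / \<beta>))))"
      unfolding trapezoidal_error_def P_def[symmetric] R_def[symmetric]
      by (intro SUP_least ennreal_leI order_trans[OF trapezoidal_error_le total])
        (use h unit_ball_holomorphic unit_ball_bound nz in auto)
  qed
qed

text \<open>
  The discretisation exponent is now \<open>\<pi> d / h\<close>, half of the one for quadrature, and the mesh is
  adapted to \<open>P = \<pi>\<^sup>2 / 2\<close>.  No factor \<open>h\<close> is left to cancel the logarithm in the denominator of the
  tail, so the lower bound \<open>l\<^sub>0\<close> for this logarithm takes its place.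
\<close>

lemma sinc_error_rate:
  assumes nz: "\<And>z. z \<in> strip d \<Longrightarrow> \<omega> z \<noteq> 0" and dg: "d * \<gamma> = pi / 2"
  shows "\<exists>C>0. \<forall>n::nat. \<forall>h. 0 < n \<and> h = ln (pi\<^sup>2 / 2 * real n / \<beta>) / (\<gamma> * real n) \<and> 0 < h \<longrightarrow>
    sinc_error n h d \<omega>
      \<le> ennreal (C * exp (- (pi\<^sup>2 / 2 * (real n + 1/2) / ln (pi\<^sup>2 / 2 * (real n + 1/2) / \<beta>))))"
proof -
  define P where "P = pi\<^sup>2 / 2"
  have P: "0 < P" by (simp add: P_def)
  obtain K l\<^sub>0 where K: "0 < K" and l\<^sub>0: "0 < l\<^sub>0"
    and l_low: "\<And>n::nat. 0 < n \<Longrightarrow> 0 < ln (P * real n / \<beta>) \<Longrightarrow> l\<^sub>0 \<le> ln (P * real n / \<beta>)"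
    and disc: "\<And>n::nat. 0 < n \<Longrightarrow> 0 < ln (P * real n / \<beta>) \<Longrightarrow> exp (- (P * real n / ln (P * real n / \<beta>)))
        \<le> K * exp (- (P * (real n + 1/2) / ln (P * (real n + 1/2) / \<beta>)))"
    and trunc: "\<And>n::nat. 0 < n \<Longrightarrow> 0 < ln (P * real n / \<beta>) \<Longrightarrow>
      exp (- (P * real n)) \<le> K * exp (- (P * (real n + 1/2) / ln (P * (real n + 1/2) / \<beta>)))"
    and low: "\<And>n::nat. 0 < n \<Longrightarrow> 0 < ln (P * real n / \<beta>) \<Longrightarrow> \<beta> \<le> P * real n / ln (P * real n / \<beta>)"
    by (rule mesh_rates[OF P pos(3)]) (rule that)
  have L0: "0 \<le> L" using has_N1_nonneg[OF N1 cont_\<omega> pos(1)] .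
  have q: "0 < 1 - exp (- \<beta>)" using pos by simp
  define C where "C = L * K / (pi * d * (1 - exp (- \<beta>))) + 2 * \<alpha> * K / (P * l\<^sub>0)"
  have C: "0 < C" unfolding C_def using L0 K q pos P l\<^sub>0 by (intro add_nonneg_pos) auto
  show ?thesis
  proof (intro exI[of _ C] conjI allI impI C, elim conjE)
    fix n :: nat and h assume n: "0 < n" and h: "h = ln (pi\<^sup>2 / 2 * real n / \<beta>) / (\<gamma> * real n)" "0 < h"
    define l where "l = ln (P * real n / \<beta>)"
    define R where "R = exp (- (P * (real n + 1/2) / ln (P * (real n + 1/2) / \<beta>)))"
    have h_eq: "h = l / (\<gamma> * real n)" using h by (simp add: l_def P_def)
    have "l = h * (\<gamma> * real n)" using h_eq n pos by simp
    then have l: "0 < l" using h(2) n pos by simp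
    have \<gamma>h: "\<gamma> * h = l / real n" using h_eq pos by simp
    have "pi * d / h = pi * (d * \<gamma>) / (\<gamma> * h)" using pos by simp
    also have "\<dots> = P * real n / l" unfolding dg \<gamma>h by (simp add: P_def power2_eq_square)
    finally have F: "pi * d / h = P * real n / l" .
    define F where "F = P * real n / l"
    have "\<beta> \<le> F" using low[OF n] l by (simp add: F_def l_def)
    have "0 < F" using \<open>\<beta> \<le> F\<close> pos by simp
    have "exp (- F) * exp (- F) \<le> exp (- \<beta>)"
      using \<open>\<beta> \<le> F\<close> \<open>0 < F\<close> unfolding exp_add[symmetric] exp_le_cancel_iff by simp
    then have den: "1 - exp (- \<beta>) \<le> 1 - exp (- F) * exp (- F)" by simp
    then have "exp (- F) * exp (- F) < 1" using q by linarith
    have "L / (2 * pi * d * sinh F) = L * exp (- F) / (pi * d * (1 - exp (- F) * exp (- F)))"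
      by (simp add: sinh_def exp_minus divide_simps)
    also have "\<dots> \<le> L * exp (- F) / (pi * d * (1 - exp (- \<beta>)))"
      using q L0 den pos \<open>exp (- F) * exp (- F) < 1\<close>
      by (intro divide_left_mono mult_left_mono mult_pos_pos) auto
    also have "\<dots> \<le> L * (K * R) / (pi * d * (1 - exp (- \<beta>)))"
      using disc[OF n] l L0 q pos unfolding F_def R_def l_def by (intro divide_right_mono mult_left_mono) auto
    finally have part1: "L / (2 * pi * d * sinh (pi * d / h)) \<le> L * K / (pi * d * (1 - exp (- \<beta>))) * R"
      unfolding F F_def by simp
    have "node_tail n h = 2 * \<alpha> * exp (- (P * real n)) / (P * l)"
      by (rule node_tail_at_mesh[OF P n h_eq l_def l])
    also have "\<dots> \<le> 2 * \<alpha> * exp (- (P * real n)) / (P * l\<^sub>0)"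
      using l_low[OF n] l l\<^sub>0 P pos unfolding l_def by (intro divide_left_mono mult_left_mono mult_pos_pos) auto
    also have "\<dots> \<le> 2 * \<alpha> * (K * R) / (P * l\<^sub>0)"
      using trunc[OF n] l P pos l\<^sub>0 unfolding R_def l_def by (intro divide_right_mono mult_left_mono) auto
    finally have part2: "node_tail n h \<le> 2 * \<alpha> * K / (P * l\<^sub>0) * R" by simp
    have total: "L / (2 * pi * d * sinh (pi * d / h)) + node_tail n h \<le> C * R"
      using part1 part2 unfolding C_def distrib_right by linarith
    show "sinc_error n h d \<omega>
      \<le> ennreal (C * exp (- (pi\<^sup>2 / 2 * (real n + 1/2) / ln (pi\<^sup>2 / 2 * (real n + 1/2) / \<beta>))))"
      unfolding sinc_error_def P_def[symmetric] R_def[symmetric]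
      by (intro SUP_least ennreal_leI order_trans[OF sinc_error_le total])
        (use h unit_ball_holomorphic unit_ball_bound nz in auto)
  qed
qed

end

theorem theorem3p1:
  fixes f :: "complex \<Rightarrow> complex"
  shows "\<forall>\<phi>\<in>Phi_as_ad f. \<forall>d \<omega> \<alpha>1 \<alpha>2 \<beta>1 \<beta>2 \<gamma>.
    admissible_with f \<phi> d \<omega> \<alpha>1 \<alpha>2 \<beta>1 \<beta>2 \<gamma> \<and> d * \<gamma> = pi / 2 \<longrightarrow>
    (\<exists>C>0. \<forall>n N :: nat. \<forall>h::real.
       n > 0 \<and> N = 2 * n + 1 \<and> h = ln (pi\<^sup>2 * real n / \<beta>2) / (\<gamma> * real n) \<and> h > 0 \<longrightarrow>
       trapezoidal_error n h d \<omega>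
         \<le> ennreal (C * exp (- (pi\<^sup>2 * real N / (2 * ln (pi\<^sup>2 * real N / (2 * \<beta>2))))))) \<and>
    (\<exists>C>0. \<forall>n N :: nat. \<forall>h::real.
       n > 0 \<and> N = 2 * n + 1 \<and> h = ln (pi\<^sup>2 * real n / (2 * \<beta>2)) / (\<gamma> * real n) \<and> h > 0 \<longrightarrow>
       sinc_error n h d \<omega>
         \<le> ennreal (C * exp (- (pi\<^sup>2 * real N / (4 * ln (pi\<^sup>2 * real N / (4 * \<beta>2)))))))"
proof (intro ballI allI impI, elim conjE)
  fix \<phi> d \<omega> \<alpha>1 \<alpha>2 \<beta>1 \<beta>2 \<gamma>
  assume adm: "admissible_with f \<phi> d \<omega> \<alpha>1 \<alpha>2 \<beta>1 \<beta>2 \<gamma>" and dg: "d * \<gamma> = pi / 2"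
  obtain L where "has_N1 \<omega> d L"
    using adm by (auto simp: admissible_with_def B_space_def)
  then interpret double_exponential_weight d \<omega> L \<alpha>2 \<beta>2 \<gamma>
    using adm by unfold_locales (auto simp: admissible_with_def B_space_def analytic_on_strip)
  have nz: "\<omega> z \<noteq> 0" if "z \<in> strip d" for z
    using adm that by (simp add: admissible_with_def)
  have N: "pi\<^sup>2 * real (2 * n + 1) / (2 * ln (pi\<^sup>2 * real (2 * n + 1) / (2 * \<beta>2)))
        = pi\<^sup>2 * (real n + 1/2) / ln (pi\<^sup>2 * (real n + 1/2) / \<beta>2)"
    "pi\<^sup>2 * real (2 * n + 1) / (4 * ln (pi\<^sup>2 * real (2 * n + 1) / (4 * \<beta>2)))
        = pi\<^sup>2 / 2 * (real n + 1/2) / ln (pi\<^sup>2 / 2 * (real n + 1/2) / \<beta>2)" for n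
  proof -
    define m where "m = real n + 1/2"
    have r: "real (2 * n + 1) = 2 * m" by (simp add: m_def)
    show "pi\<^sup>2 * real (2 * n + 1) / (2 * ln (pi\<^sup>2 * real (2 * n + 1) / (2 * \<beta>2)))
        = pi\<^sup>2 * (real n + 1/2) / ln (pi\<^sup>2 * (real n + 1/2) / \<beta>2)"
      "pi\<^sup>2 * real (2 * n + 1) / (4 * ln (pi\<^sup>2 * real (2 * n + 1) / (4 * \<beta>2)))
        = pi\<^sup>2 / 2 * (real n + 1/2) / ln (pi\<^sup>2 / 2 * (real n + 1/2) / \<beta>2)"
      unfolding r m_def[symmetric] by (simp_all add: mult_ac)
  qed
  have mesh: "pi\<^sup>2 * real n / (2 * \<beta>2) = pi\<^sup>2 / 2 * real n / \<beta>2" for n by simp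
  obtain C where C: "C > 0" "\<And>n h. 0 < n \<Longrightarrow> h = ln (pi\<^sup>2 * real n / \<beta>2) / (\<gamma> * real n) \<Longrightarrow> 0 < h \<Longrightarrow>
      trapezoidal_error n h d \<omega>
        \<le> ennreal (C * exp (- (pi\<^sup>2 * (real n + 1/2) / ln (pi\<^sup>2 * (real n + 1/2) / \<beta>2))))"
    using trapezoidal_error_rate[OF nz dg] by auto
  obtain C' where C': "C' > 0" "\<And>n h. 0 < n \<Longrightarrow> h = ln (pi\<^sup>2 / 2 * real n / \<beta>2) / (\<gamma> * real n) \<Longrightarrow> 0 < h \<Longrightarrow>
      sinc_error n h d \<omega>
        \<le> ennreal (C' * exp (- (pi\<^sup>2 / 2 * (real n + 1/2) / ln (pi\<^sup>2 / 2 * (real n + 1/2) / \<beta>2))))"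
    using sinc_error_rate[OF nz dg] by auto
  show "(\<exists>C>0. \<forall>n N :: nat. \<forall>h::real.
       n > 0 \<and> N = 2 * n + 1 \<and> h = ln (pi\<^sup>2 * real n / \<beta>2) / (\<gamma> * real n) \<and> h > 0 \<longrightarrow>
       trapezoidal_error n h d \<omega>
         \<le> ennreal (C * exp (- (pi\<^sup>2 * real N / (2 * ln (pi\<^sup>2 * real N / (2 * \<beta>2))))))) \<and>
    (\<exists>C>0. \<forall>n N :: nat. \<forall>h::real.
       n > 0 \<and> N = 2 * n + 1 \<and> h = ln (pi\<^sup>2 * real n / (2 * \<beta>2)) / (\<gamma> * real n) \<and> h > 0 \<longrightarrow>
       sinc_error n h d \<omega>
         \<le> ennreal (C * exp (- (pi\<^sup>2 * real N / (4 * ln (pi\<^sup>2 * real N / (4 * \<beta>2)))))))"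
    (is "(\<exists>C>0. ?T C) \<and> (\<exists>C>0. ?S C)")
  proof (intro conjI exI[of "\<lambda>C. C > 0 \<and> ?T C" C] exI[of "\<lambda>C. C > 0 \<and> ?S C" C'])
    show "?T C"
    proof (intro allI impI, elim conjE)
      fix n N :: nat and h :: real
      assume "n > 0" "N = 2 * n + 1" "h = ln (pi\<^sup>2 * real n / \<beta>2) / (\<gamma> * real n)" "h > 0"
      then show "trapezoidal_error n h d \<omega>
          \<le> ennreal (C * exp (- (pi\<^sup>2 * real N / (2 * ln (pi\<^sup>2 * real N / (2 * \<beta>2))))))"
        using C(2)[of n h] by (simp only: N)
    qed
    show "?S C'"
    proof (intro allI impI, elim conjE)
      fix n N :: nat and h :: real
      assume "n > 0" "N = 2 * n + 1" "h = ln (pi\<^sup>2 * real n / (2 * \<beta>2)) / (\<gamma> * real n)" "h > 0"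
      then show "sinc_error n h d \<omega>
          \<le> ennreal (C' * exp (- (pi\<^sup>2 * real N / (4 * ln (pi\<^sup>2 * real N / (4 * \<beta>2))))))"
        using C'(2)[of n h] by (simp only: N mesh)
    qed
  qed (rule C C')+
qed

end
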